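(* Let $\Upsilon$ be a gain signed graph. An edge set $S\subseteq E$, regarded as the spanning subgraph $(V,S)$, is independent in $M(\Upsilon)$ if and only if it is of one of the following types: (I) (hyperbalanced) every component of $S$ is a tree or a sign-unbalanced unicycle, and $S$ contains no loose edges; (II) (hyperfrustrated) every component is a tree or a sign-unbalanced unicycle, except that there may be one edge component $S_0$ that is either a sign-balanced unicycle, or a loose edge, or a sign-unbalanced theta graph or a handcuff with at least one negative figure, possibly with attached trees; and in each case the unique sign circuit in $S_0$ is non-neutral.
   Context: Let $\mathbb{K}$ be a field of characteristic $\ne2$. A graph $\Gamma=(V,E)$ has vertex set $V=\{v_1,\dots,v_n\}$ and finite edge set $E$; edges are links (two ends at distinct vertices), loops (two ends at one vertex), half edges (one end) or loose edges (no ends); parallel edges allowed. A gain signed graph $\Upsilon=(\Gamma,\sigma,\varphi)$: $\sigma:E\to\{\pm1\}$ (half edges negative, loose edges positive); with an orientation $\tau$ (signs $\tau(v,e)\in\{\pm1\}$ on edge ends, $\tau(v,e)\tau(w,e)=-\sigma(e)$ for a link or loop with ends $v,w$) each edge has gain $\varphi(e)\in\mathbb{K}$, negated on reorientation. Neutral = gain $0$. Walk gain of $W=u_0e_1\cdots e_lu_l$: $\varphi(W)=-\sum_i\varphi(e_i)\sigma(W_{0,i-1})\tau(u_{i-1},e_i)$, $\sigma(W_{0,j})=\prod_{i\le j}\sigma(e_i)$. Ultrawalks may begin with a half edge $e_0$ at $u_0$ and/or end with a half edge $e_{l+1}$ at $u_l$; their gain adds $\tau(u_0,e_0)\varphi(e_0)$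 and/or $-\varphi(e_{l+1})\sigma(W_{0,l})\tau(u_l,e_{l+1})$ to $\varphi(W_{0,l})$. Circles: connected 2-regular subgraphs, sign = product of edge signs; a negative figure is a negative circle or a half edge. A sign circuit is a positive circle, a loose edge, or a handcuff of two negative figures (see below). Its gain: the edge gain for a loose edge; else $\varphi(W)$ for a circuit walk (once around a positive circle; for a handcuff with figures $C_1,C_2$, connecting path $P$ of length $\ge0$: around $C_1$, along $P$, around $C_2$, back along $P$ if both circles; from half edge $C_1$ along $P$, around $C_2$, back, ending with $C_1$ if $C_1$ half edge and $C_2$ circle; from one half edge along $P$ to the other if both half edges); well defined up to sign; neutral if $0$. An edge set is hyperbalanced if all sign circuits in it are neutral, hyperfrustrated otherwise; sign balanced if it has no negative circle and no half edge. Components of $S$: connected components of $(V,S)$ (loose edges excluded; isolated vertices are trivial trees); edge components: each loose edge and each non-trivial component. $M(\Upsilon)$: matroid on $E$ with rank $n-b_\Sigma(S)+\delta(S)$, where $b_\Sigma$ counts sign-balanced components and $\delta=0$ if $S$ hyperbalanced, $1$ otherwise. A handcuff is two figures (each a circle or a half edge) that have at most one common vertex, together with a path (of length $0$ if they share a vertex) joining them and meeting them only at its endpoints. A unicycle is a connected graph consisting of a circle or a half edge with trees attached; it is sign balanced (a positive circle with trees) or sign unbalanced (a negative circle or half edge with trees). A theta graph is the union of three internally disjoint paths with the same two endpoints; it is sign unbalanced if it contains a negative circle. *)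

theory Defs
  imports Main
begin

section \<open>Gain signed graphs\<close>

text \<open>
  An edge carries the list of the vertices at which its ends lie: two distinct vertices for a
  link, the same vertex twice for a loop, one vertex for a half edge, none for a loose edge.
  An edge end is a position in this list, so that the two ends of a loop stay distinguishable
  and can carry different orientation signs; \<open>orient G e i\<close> is $\tau(v,e)$ at the end
  \<open>i\<close> of \<open>e\<close>, where $v$ is \<open>ends G e ! i\<close>.

  The gain of an edge depends on the orientation: reversing all orientation signs of an edge
  negates its gain.  The record stores one orientation, arbitrary, together with the edge gains
  with respect to it.
\<close>

record ('v, 'e, 'k) gain_graph =
  verts :: "'v set"
  edges :: "'e set"
  ends :: "'e \<Rightarrow> 'v list"
  esign :: "'e \<Rightarrow> int"
  orient :: "'e \<Rightarrow> nat \<Rightarrow> int"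
  gain :: "'e \<Rightarrow> 'k"

definition two_ended :: "('v, 'e, 'k) gain_graph \<Rightarrow> 'e \<Rightarrow> bool" where
  "two_ended G e \<longleftrightarrow> e \<in> edges G \<and> length (ends G e) = 2"

definition half_edge :: "('v, 'e, 'k) gain_graph \<Rightarrow> 'e \<Rightarrow> bool" where
  "half_edge G e \<longleftrightarrow> e \<in> edges G \<and> length (ends G e) = 1"

definition loose_edge :: "('v, 'e, 'k) gain_graph \<Rightarrow> 'e \<Rightarrow> bool" where
  "loose_edge G e \<longleftrightarrow> e \<in> edges G \<and> ends G e = []"

locale gain_signed_graph =
  fixes G :: "('v, 'e, 'k :: field) gain_graph"
  assumes char_not_2: "CHAR('k) \<noteq> 2"
    and finite_verts: "finite (verts G)"
    and finite_edges: "finite (edges G)"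
    and length_ends: "e \<in> edges G \<Longrightarrow> length (ends G e) \<le> 2"
    and ends_in_verts: "e \<in> edges G \<Longrightarrow> set (ends G e) \<subseteq> verts G"
    and esign: "e \<in> edges G \<Longrightarrow> esign G e \<in> {1, -1}"
    and half_edge_negative: "half_edge G e \<Longrightarrow> esign G e = -1"
    and loose_edge_positive: "loose_edge G e \<Longrightarrow> esign G e = 1"
    and orient: "e \<in> edges G \<Longrightarrow> i < length (ends G e) \<Longrightarrow> orient G e i \<in> {1, -1}"
    and orient_esign: "two_ended G e \<Longrightarrow> orient G e 0 * orient G e 1 = - esign G e"


section \<open>Walks and their gains\<close>

text \<open>
  A step \<open>(e, i)\<close> of a walk traverses the link or loop \<open>e\<close> from its end \<open>i\<close> to its other end
  \<open>1 - i\<close>.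
\<close>

type_synonym 'e step = "'e \<times> nat"

fun step_target :: "('v, 'e, 'k) gain_graph \<Rightarrow> 'e step \<Rightarrow> 'v" where
  "step_target G (e, i) = ends G e ! (1 - i)"

fun walk :: "('v, 'e, 'k) gain_graph \<Rightarrow> 'v \<Rightarrow> 'e step list \<Rightarrow> 'v \<Rightarrow> bool" where
  "walk G u [] v \<longleftrightarrow> u \<in> verts G \<and> u = v"
| "walk G u ((e, i) # W) v \<longleftrightarrow>
     two_ended G e \<and> i < 2 \<and> ends G e ! i = u \<and> walk G (step_target G (e, i)) W v"

definition walk_verts :: "('v, 'e, 'k) gain_graph \<Rightarrow> 'v \<Rightarrow> 'e step list \<Rightarrow> 'v list" where
  "walk_verts G u W = u # map (step_target G) W"

definition walk_edges :: "'e step list \<Rightarrow> 'e set" where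
  "walk_edges W = set (map fst W)"

definition rev_walk :: "'e step list \<Rightarrow> 'e step list" where
  "rev_walk W = rev (map (\<lambda>(e, i). (e, 1 - i)) W)"

definition walk_path :: "('v, 'e, 'k) gain_graph \<Rightarrow> 'v \<Rightarrow> 'e step list \<Rightarrow> 'v \<Rightarrow> bool" where
  "walk_path G u W v \<longleftrightarrow> walk G u W v \<and> distinct (walk_verts G u W)"

definition walk_sign :: "('v, 'e, 'k) gain_graph \<Rightarrow> 'e step list \<Rightarrow> int" where
  "walk_sign G W = prod_list (map (esign G \<circ> fst) W)"

definition walk_gain :: "('v, 'e, 'k :: field) gain_graph \<Rightarrow> 'e step list \<Rightarrow> 'k" where
  "walk_gain G W =
     - (\<Sum>j<length W. case W ! j of (e, i) \<Rightarrow>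
          gain G e * of_int (walk_sign G (take j W)) * of_int (orient G e i))"

text \<open>
  The optional edges are the initial and the final half edge; the sign in the last
  summand is that of the walk between them, so it does not involve the initial half edge.
\<close>

definition ultrawalk_gain ::
  "('v, 'e, 'k :: field) gain_graph \<Rightarrow> 'e option \<Rightarrow> 'e step list \<Rightarrow> 'e option \<Rightarrow> 'k" where
  "ultrawalk_gain G h W h' =
     (case h of None \<Rightarrow> 0 | Some e \<Rightarrow> of_int (orient G e 0) * gain G e)
     + walk_gain G W
     + (case h' of None \<Rightarrow> 0
        | Some e \<Rightarrow> - (gain G e * of_int (walk_sign G W) * of_int (orient G e 0)))"


section \<open>Connectedness and components\<close>

definition verts_of :: "('v, 'e, 'k) gain_graph \<Rightarrow> 'e set \<Rightarrow> 'v set" where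
  "verts_of G S = (\<Union>e\<in>S. set (ends G e))"

definition joined :: "('v, 'e, 'k) gain_graph \<Rightarrow> 'e set \<Rightarrow> 'v \<Rightarrow> 'v \<Rightarrow> bool" where
  "joined G S u v \<longleftrightarrow> (\<exists>W. walk G u W v \<and> walk_edges W \<subseteq> S)"

definition connected_subgraph :: "('v, 'e, 'k) gain_graph \<Rightarrow> 'v set \<Rightarrow> 'e set \<Rightarrow> bool" where
  "connected_subgraph G X S \<longleftrightarrow>
     X \<noteq> {} \<and> X \<subseteq> verts G \<and> S \<subseteq> edges G \<and> verts_of G S \<subseteq> X \<and>
     (\<forall>u\<in>X. \<forall>v\<in>X. joined G S u v)"

text \<open>
  The components of the spanning subgraph with edge set \<open>S\<close> are given as pairs of a vertex set
  and an edge set.  Loose edges belong to no component; an isolated vertex \<open>v\<close> gives the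
  component \<open>({v}, {})\<close>.
\<close>

definition edges_at :: "('v, 'e, 'k) gain_graph \<Rightarrow> 'e set \<Rightarrow> 'v set \<Rightarrow> 'e set" where
  "edges_at G S X = {e \<in> S. set (ends G e) \<inter> X \<noteq> {}}"

definition graph_components :: "('v, 'e, 'k) gain_graph \<Rightarrow> 'e set \<Rightarrow> ('v set \<times> 'e set) set" where
  "graph_components G S =
     (\<lambda>u. let X = {v \<in> verts G. joined G S u v} in (X, edges_at G S X)) ` verts G"

definition edge_components :: "('v, 'e, 'k) gain_graph \<Rightarrow> 'e set \<Rightarrow> 'e set set" where
  "edge_components G S =
     {{e} | e. e \<in> S \<and> loose_edge G e} \<union> {T. \<exists>X. (X, T) \<in> graph_components G S \<and> T \<noteq> {}}"


section \<open>Circles, figures and handcuffs\<close>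

text \<open>A loop contributes two to the degree of its vertex.\<close>

definition degree :: "('v, 'e, 'k) gain_graph \<Rightarrow> 'e set \<Rightarrow> 'v \<Rightarrow> nat" where
  "degree G S v = (\<Sum>e\<in>S. count_list (ends G e) v)"

text \<open>
  Half edges have to be excluded explicitly: a path with a half edge at both of its end vertices
  is also connected with all degrees equal to two, but it is not a circle.
\<close>

definition circle :: "('v, 'e, 'k) gain_graph \<Rightarrow> 'e set \<Rightarrow> bool" where
  "circle G C \<longleftrightarrow>
     (\<forall>e\<in>C. two_ended G e) \<and> connected_subgraph G (verts_of G C) C \<and>
     (\<forall>v\<in>verts_of G C. degree G C v = 2)"

definition positive_circle :: "('v, 'e, 'k) gain_graph \<Rightarrow> 'e set \<Rightarrow> bool" where
  "positive_circle G C \<longleftrightarrow> circle G C \<and> (\<Prod>e\<in>C. esign G e) = 1"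

definition negative_circle :: "('v, 'e, 'k) gain_graph \<Rightarrow> 'e set \<Rightarrow> bool" where
  "negative_circle G C \<longleftrightarrow> circle G C \<and> (\<Prod>e\<in>C. esign G e) = -1"

definition figure :: "('v, 'e, 'k) gain_graph \<Rightarrow> 'e set \<Rightarrow> bool" where
  "figure G C \<longleftrightarrow> circle G C \<or> (\<exists>h. half_edge G h \<and> C = {h})"

definition negative_figure :: "('v, 'e, 'k) gain_graph \<Rightarrow> 'e set \<Rightarrow> bool" where
  "negative_figure G C \<longleftrightarrow> negative_circle G C \<or> (\<exists>h. half_edge G h \<and> C = {h})"

text \<open>
  The two figures and the connecting path, as a walk from \<open>u\<close> to \<open>v\<close>.  Distinctness of the
  figures is needed, since a half edge or a loop shares just one vertex with itself.
\<close>

definition handcuff ::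
  "('v, 'e, 'k) gain_graph \<Rightarrow> 'e set \<Rightarrow> 'v \<Rightarrow> 'e step list \<Rightarrow> 'v \<Rightarrow> 'e set \<Rightarrow> bool" where
  "handcuff G C1 u P v C2 \<longleftrightarrow>
     figure G C1 \<and> figure G C2 \<and> C1 \<noteq> C2 \<and>
     card (verts_of G C1 \<inter> verts_of G C2) \<le> 1 \<and>
     walk_path G u P v \<and>
     set (walk_verts G u P) \<inter> verts_of G C1 = {u} \<and>
     set (walk_verts G u P) \<inter> verts_of G C2 = {v} \<and>
     (verts_of G C1 \<inter> verts_of G C2 \<noteq> {} \<longrightarrow> P = [])"


section \<open>Sign circuits, balance and the matroid\<close>

definition sign_circuit :: "('v, 'e, 'k) gain_graph \<Rightarrow> 'e set \<Rightarrow> bool" where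
  "sign_circuit G C \<longleftrightarrow>
     positive_circle G C \<or>
     (\<exists>e. loose_edge G e \<and> C = {e}) \<or>
     (\<exists>C1 u P v C2. handcuff G C1 u P v C2 \<and> negative_figure G C1 \<and> negative_figure G C2 \<and>
        C = C1 \<union> walk_edges P \<union> C2)"

definition once_around :: "('v, 'e, 'k) gain_graph \<Rightarrow> 'e set \<Rightarrow> 'v \<Rightarrow> 'e step list \<Rightarrow> bool" where
  "once_around G C u W \<longleftrightarrow> walk G u W u \<and> distinct (map fst W) \<and> walk_edges W = C"

text \<open>
  \<open>circuit_gain G C g\<close> means that \<open>g\<close> is the gain of some circuit walk of the sign circuit
  \<open>C\<close>, or the edge gain if \<open>C\<close> is a loose edge.  The gain of \<open>C\<close> is determined only up to sign,
  whence the relation.  The case of a circle \<open>C1\<close> and a half edge \<open>C2\<close> is the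
  mixed case with the figures interchanged.
\<close>

inductive circuit_gain :: "('v, 'e, 'k :: field) gain_graph \<Rightarrow> 'e set \<Rightarrow> 'k \<Rightarrow> bool"
  for G :: "('v, 'e, 'k) gain_graph" where
  loose: "loose_edge G e \<Longrightarrow> circuit_gain G {e} (gain G e)"
| circle: "positive_circle G C \<Longrightarrow> once_around G C u W \<Longrightarrow> circuit_gain G C (walk_gain G W)"
| circle_circle:
    "handcuff G C1 u P v C2 \<Longrightarrow> negative_circle G C1 \<Longrightarrow> negative_circle G C2 \<Longrightarrow>
     once_around G C1 u W1 \<Longrightarrow> once_around G C2 v W2 \<Longrightarrow>
     circuit_gain G (C1 \<union> walk_edges P \<union> C2) (walk_gain G (W1 @ P @ W2 @ rev_walk P))"
| half_circle:
    "handcuff G {h} u P v C2 \<Longrightarrow> half_edge G h \<Longrightarrow> negative_circle G C2 \<Longrightarrow>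
     once_around G C2 v W2 \<Longrightarrow>
     circuit_gain G ({h} \<union> walk_edges P \<union> C2)
       (ultrawalk_gain G (Some h) (P @ W2 @ rev_walk P) (Some h))"
| half_half:
    "handcuff G {h} u P v {h'} \<Longrightarrow> half_edge G h \<Longrightarrow> half_edge G h' \<Longrightarrow>
     circuit_gain G ({h} \<union> walk_edges P \<union> {h'}) (ultrawalk_gain G (Some h) P (Some h'))"

definition neutral_circuit :: "('v, 'e, 'k :: field) gain_graph \<Rightarrow> 'e set \<Rightarrow> bool" where
  "neutral_circuit G C \<longleftrightarrow> circuit_gain G C 0"

definition hyperbalanced :: "('v, 'e, 'k :: field) gain_graph \<Rightarrow> 'e set \<Rightarrow> bool" where
  "hyperbalanced G S \<longleftrightarrow> (\<forall>C. C \<subseteq> S \<and> sign_circuit G C \<longrightarrow> neutral_circuit G C)"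

definition sign_balanced :: "('v, 'e, 'k) gain_graph \<Rightarrow> 'e set \<Rightarrow> bool" where
  "sign_balanced G S \<longleftrightarrow> \<not> (\<exists>C. C \<subseteq> S \<and> negative_circle G C) \<and> \<not> (\<exists>h\<in>S. half_edge G h)"

definition num_balanced :: "('v, 'e, 'k) gain_graph \<Rightarrow> 'e set \<Rightarrow> nat" where
  "num_balanced G S = card {(X, T) \<in> graph_components G S. sign_balanced G T}"

text \<open>
  The matroid is given by its rank function.  The components partition the vertex set, so the
  subtraction of natural numbers is not truncated.
\<close>

definition matroid_rank :: "('v, 'e, 'k :: field) gain_graph \<Rightarrow> 'e set \<Rightarrow> nat" where
  "matroid_rank G S = card (verts G) - num_balanced G S + (if hyperbalanced G S then 0 else 1)"

definition matroid_independent :: "('v, 'e, 'k :: field) gain_graph \<Rightarrow> 'e set \<Rightarrow> bool" where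
  "matroid_independent G S \<longleftrightarrow> S \<subseteq> edges G \<and> matroid_rank G S = card S"


section \<open>Trees, unicycles, theta graphs\<close>

definition tree :: "('v, 'e, 'k) gain_graph \<Rightarrow> 'v set \<Rightarrow> 'e set \<Rightarrow> bool" where
  "tree G X T \<longleftrightarrow>
     connected_subgraph G X T \<and> (\<forall>e\<in>T. two_ended G e) \<and> \<not> (\<exists>C. C \<subseteq> T \<and> circle G C)"

text \<open>\<open>S\<close> consists of \<open>D\<close> and trees that meet \<open>D\<close> in one vertex each.\<close>

definition with_attached_trees :: "('v, 'e, 'k) gain_graph \<Rightarrow> 'e set \<Rightarrow> 'e set \<Rightarrow> bool" where
  "with_attached_trees G D S \<longleftrightarrow>
     D \<subseteq> S \<and>
     (\<forall>T\<in>edge_components G (S - D).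
        tree G (verts_of G T) T \<and> card (verts_of G T \<inter> verts_of G D) = 1)"

definition balanced_unicycle :: "('v, 'e, 'k) gain_graph \<Rightarrow> 'e set \<Rightarrow> bool" where
  "balanced_unicycle G S \<longleftrightarrow> (\<exists>C. positive_circle G C \<and> with_attached_trees G C S)"

definition unbalanced_unicycle :: "('v, 'e, 'k) gain_graph \<Rightarrow> 'e set \<Rightarrow> bool" where
  "unbalanced_unicycle G S \<longleftrightarrow> (\<exists>C. negative_figure G C \<and> with_attached_trees G C S)"

definition theta_graph :: "('v, 'e, 'k) gain_graph \<Rightarrow> 'e set \<Rightarrow> bool" where
  "theta_graph G D \<longleftrightarrow>
     (\<exists>x y P Q R. x \<noteq> y \<and> walk_path G x P y \<and> walk_path G x Q y \<and> walk_path G x R y \<and>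
        walk_edges P \<inter> walk_edges Q = {} \<and> walk_edges P \<inter> walk_edges R = {} \<and>
        walk_edges Q \<inter> walk_edges R = {} \<and>
        set (walk_verts G x P) \<inter> set (walk_verts G x Q) = {x, y} \<and>
        set (walk_verts G x P) \<inter> set (walk_verts G x R) = {x, y} \<and>
        set (walk_verts G x Q) \<inter> set (walk_verts G x R) = {x, y} \<and>
        D = walk_edges P \<union> walk_edges Q \<union> walk_edges R)"

definition unbalanced_theta :: "('v, 'e, 'k) gain_graph \<Rightarrow> 'e set \<Rightarrow> bool" where
  "unbalanced_theta G D \<longleftrightarrow> theta_graph G D \<and> (\<exists>C. C \<subseteq> D \<and> negative_circle G C)"

definition unbalanced_handcuff :: "('v, 'e, 'k) gain_graph \<Rightarrow> 'e set \<Rightarrow> bool" where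
  "unbalanced_handcuff G D \<longleftrightarrow>
     (\<exists>C1 u P v C2. handcuff G C1 u P v C2 \<and> (negative_figure G C1 \<or> negative_figure G C2) \<and>
        D = C1 \<union> walk_edges P \<union> C2)"


section \<open>The two types of edge sets\<close>

definition type_I :: "('v, 'e, 'k :: field) gain_graph \<Rightarrow> 'e set \<Rightarrow> bool" where
  "type_I G S \<longleftrightarrow>
     hyperbalanced G S \<and>
     (\<forall>(X, T)\<in>graph_components G S. tree G X T \<or> unbalanced_unicycle G T) \<and>
     \<not> (\<exists>e\<in>S. loose_edge G e)"

definition exceptional_shape :: "('v, 'e, 'k) gain_graph \<Rightarrow> 'e set \<Rightarrow> bool" where
  "exceptional_shape G T \<longleftrightarrow>
     balanced_unicycle G T \<or>
     (\<exists>e. loose_edge G e \<and> T = {e}) \<or>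
     (\<exists>D. (unbalanced_theta G D \<or> unbalanced_handcuff G D) \<and> with_attached_trees G D T)"

definition exceptional :: "('v, 'e, 'k :: field) gain_graph \<Rightarrow> 'e set \<Rightarrow> bool" where
  "exceptional G T \<longleftrightarrow>
     exceptional_shape G T \<and>
     (\<exists>!C. C \<subseteq> T \<and> sign_circuit G C) \<and>
     (\<forall>C. C \<subseteq> T \<and> sign_circuit G C \<longrightarrow> \<not> neutral_circuit G C)"

definition ordinary :: "('v, 'e, 'k) gain_graph \<Rightarrow> 'e set \<Rightarrow> bool" where
  "ordinary G T \<longleftrightarrow> tree G (verts_of G T) T \<or> unbalanced_unicycle G T"

text \<open>
  Quantifying over edge components loses only the isolated vertices, which are trees,
  and includes the loose edges, which are never ordinary.
\<close>

definition type_II :: "('v, 'e, 'k :: field) gain_graph \<Rightarrow> 'e set \<Rightarrow> bool" where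
  "type_II G S \<longleftrightarrow>
     \<not> hyperbalanced G S \<and>
     card {T \<in> edge_components G S. \<not> ordinary G T} \<le> 1 \<and>
     (\<forall>T\<in>edge_components G S. \<not> ordinary G T \<longrightarrow> exceptional G T)"

end

(*
  Give an edge component U with vertex set V_U the excess |U| - |V_U| + b, where b = 1 if U is
  sign balanced and b = 0 otherwise, and a loose edge the excess 1.  Excesses are nonnegative and
  add up to |S| + b_Sigma(S) - n, so S is independent iff they add up to delta(S).  Deleting an
  edge of a figure leaves a connected graph connected, which bounds from below the number of
  edges of a connected graph containing one, two or three figures.  Hence excess 0 means tree or
  unbalanced unicycle, and such components contain no sign circuit.  If the excess is 1, a
  balanced component contains a single figure; in an unbalanced one a negative figure together
  with a second figure yields a handcuff if they are edge-disjoint and a theta graph otherwise,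
  and two different sign circuits would force too many edges.  Gains enter only through delta.
*)
theory Submission
  imports Defs
begin

section \<open>Walks\<close>

text \<open>Two substitutes carry the proof. A minimal nonempty set of links and loops that covers
  no more vertices than it has edges is a circle. And where all degrees are even, a trail can be
  removed without separating its ends; this supplies the detour around a deleted edge of a circle.
  The counts are uniform because a half edge, like a circle, has as many edges as vertices, while
  theta graphs and handcuffs have one edge more. Attached trees preserve this difference, and
  conversely equal differences force everything outside the core to consist of attached trees, so
  shapes are recognized by counting. Uniqueness of the sign circuit rests on one fact: if a
  connected graph has at most one edge more than vertices, then, given two distinct figures, every
  edge of any figure lies in one of the two.\<close>

lemma verts_of_empty [simp]: "verts_of G {} = {}"
  by (simp add: verts_of_def)

lemma verts_of_Un: "verts_of G (A \<union> B) = verts_of G A \<union> verts_of G B"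
  by (auto simp: verts_of_def)

lemma verts_of_mono: "A \<subseteq> B \<Longrightarrow> verts_of G A \<subseteq> verts_of G B"
  by (auto simp: verts_of_def)

lemma walk_edges_Nil [simp]: "walk_edges [] = {}"
  by (simp add: walk_edges_def)

lemma walk_edges_Cons [simp]: "walk_edges (s # W) = insert (fst s) (walk_edges W)"
  by (simp add: walk_edges_def)

lemma walk_edges_append [simp]: "walk_edges (W @ W') = walk_edges W \<union> walk_edges W'"
  by (auto simp: walk_edges_def)

lemma finite_walk_edges [simp]: "finite (walk_edges W)"
  by (simp add: walk_edges_def)

lemma walk_verts_Nil [simp]: "walk_verts G u [] = [u]"
  by (simp add: walk_verts_def)

lemma walk_verts_Cons [simp]:
  "walk_verts G u (s # W) = u # walk_verts G (step_target G s) W"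
  by (simp add: walk_verts_def)

text \<open>Only the empty walk tests membership in \<open>verts G\<close>, so a walk can be cut at
  a point only if its vertices are known to lie there; hence the two hypotheses.\<close>

lemma walk_append:
  assumes "u \<in> verts G" "\<And>e. two_ended G e \<Longrightarrow> set (ends G e) \<subseteq> verts G"
  shows "walk G u (W @ W') v \<longleftrightarrow> (\<exists>w. walk G u W w \<and> walk G w W' v)"
  using assms(1)
proof (induction W arbitrary: u)
  case Nil
  then show ?case by simp
next
  case (Cons s W)
  obtain e i where s: "s = (e, i)" by fastforce
  have "ends G e ! (1 - i) \<in> verts G" if "two_ended G e"
    using that assms(2)[of e]
    by (metis diff_le_self le_imp_less_Suc nth_mem numeral_2_eq_2 One_nat_def subsetD two_ended_def)
  then show ?case using Cons s by auto
qed

context gain_signed_graph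
begin

lemma two_ended_ends:
  assumes "two_ended G e"
  obtains a b where "ends G e = [a, b]" "a \<in> verts G" "b \<in> verts G"
proof -
  obtain a b where *: "ends G e = [a, b]"
    using assms by (auto simp: two_ended_def length_Suc_conv numeral_2_eq_2)
  then show ?thesis using that ends_in_verts[of e] assms by (auto simp: two_ended_def)
qed

lemma half_edge_ends:
  assumes "half_edge G h"
  obtains a where "ends G h = [a]" "a \<in> verts G"
  using assms ends_in_verts[of h] that by (auto simp: half_edge_def length_Suc_conv)

lemma not_half_two_ended: "half_edge G h \<Longrightarrow> \<not> two_ended G h"
  by (simp add: half_edge_def two_ended_def)

lemma edge_cases:
  assumes "e \<in> edges G"
  obtains "two_ended G e" | "half_edge G e" | "loose_edge G e"
  using length_ends[OF assms] assms
  unfolding two_ended_def half_edge_def loose_edge_def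
  by (metis One_nat_def le_SucE le_zero_eq length_0_conv numeral_2_eq_2)

lemma step_ends:
  assumes "two_ended G e" "i < 2"
  shows "set (ends G e) = {ends G e ! i, ends G e ! (1 - i)}"
  using assms by (elim two_ended_ends) (auto simp: less_2_cases_iff)

lemma walk_end_in_verts: "walk G u W v \<Longrightarrow> u \<in> verts G \<and> v \<in> verts G"
proof (induction W arbitrary: u)
  case (Cons s W)
  obtain e i where s: "s = (e, i)" by fastforce
  then show ?case using Cons step_ends[of e i] ends_in_verts[of e] by (auto simp: two_ended_def)
qed auto

lemma set_walk_verts:
  "walk G u W v \<Longrightarrow> set (walk_verts G u W) = insert u (verts_of G (walk_edges W))"
proof (induction W arbitrary: u)
  case (Cons s W)
  obtain e i where s: "s = (e, i)" by fastforce
  then show ?case using Cons step_ends[of e i] by (auto simp: verts_of_def)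
qed simp

lemma walk_end_in_walk_verts:
  "walk G u W v \<Longrightarrow> u \<in> set (walk_verts G u W) \<and> v \<in> set (walk_verts G u W)"
  by (induction W arbitrary: u) auto

lemma walk_edges_two_ended: "walk G u W v \<Longrightarrow> e \<in> walk_edges W \<Longrightarrow> two_ended G e"
  by (induction W arbitrary: u) auto

lemma walk_edge:
  assumes "two_ended G e" "ends G e = [a, b]"
  shows "walk G a [(e, 0)] b" "walk G b [(e, 1)] a"
  using assms two_ended_ends[OF assms(1)] by auto

lemma joined_refl: "v \<in> verts G \<Longrightarrow> joined G S v v"
  unfolding joined_def by (rule exI[of _ "[]"]) simp

lemma joined_in_verts: "joined G S u v \<Longrightarrow> u \<in> verts G \<and> v \<in> verts G"
  unfolding joined_def using walk_end_in_verts by blast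

lemma joined_mono: "joined G S u v \<Longrightarrow> S \<subseteq> T \<Longrightarrow> joined G T u v"
  unfolding joined_def by blast

lemma joined_trans: "joined G S u v \<Longrightarrow> joined G S v w \<Longrightarrow> joined G S u w"
proof -
  assume "joined G S u v" "joined G S v w"
  then obtain W W' where "walk G u W v" "walk_edges W \<subseteq> S" "walk G v W' w" "walk_edges W' \<subseteq> S"
    unfolding joined_def by auto
  moreover from this have "walk G u (W @ W') w"
    using walk_append[of u G W W' w] walk_end_in_verts ends_in_verts
    by (auto simp: two_ended_def)
  ultimately show ?thesis unfolding joined_def by (intro exI[of _ "W @ W'"]) simp
qed

lemma joined_edge:
  assumes "e \<in> S" "two_ended G e" "a \<in> set (ends G e)" "b \<in> set (ends G e)"
  shows "joined G S a b"
proof -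
  obtain x y where e: "ends G e = [x, y]" "x \<in> verts G" "y \<in> verts G"
    using two_ended_ends[OF assms(2)] by blast
  have "joined G S x y" "joined G S y x"
    unfolding joined_def using walk_edge[OF assms(2) e(1)] assms(1)
    by (metis empty_subsetI fst_conv insert_subset walk_edges_Cons walk_edges_Nil)+
  then show ?thesis using assms e joined_refl by auto
qed

text \<open>The induction principle for \<open>joined\<close>: later connectivity arguments reduce
  to the choice of \<open>Y\<close> and rarely handle walks.\<close>

lemma joined_closed:
  assumes "joined G S u v" "u \<in> Y"
    and "\<And>e. e \<in> S \<Longrightarrow> two_ended G e \<Longrightarrow> set (ends G e) \<inter> Y \<noteq> {} \<Longrightarrow> set (ends G e) \<subseteq> Y"
  shows "v \<in> Y"
proof -
  have "walk G u W v \<Longrightarrow> walk_edges W \<subseteq> S \<Longrightarrow> u \<in> Y \<Longrightarrow> v \<in> Y" for W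
  proof (induction W arbitrary: u)
    case (Cons s W)
    obtain e i where s: "s = (e, i)" by fastforce
    with Cons.prems have "ends G e ! (1 - i) \<in> Y"
      using assms(3)[of e] step_ends[of e i] by auto
    then show ?case using Cons s by auto
  qed simp
  then show ?thesis using assms unfolding joined_def by blast
qed

lemma joined_sym: "joined G S u v \<Longrightarrow> joined G S v u"
proof -
  assume *: "joined G S u v"
  \<comment> \<open>The possibility of returning to \<open>u\<close> is preserved along edges, so no
    walk has to be reversed.\<close>
  have "v \<in> {w. joined G S w u}"
  proof (rule joined_closed[OF *])
    show "u \<in> {w. joined G S w u}" using * joined_refl joined_in_verts by auto
  next
    fix e
    assume "e \<in> S" "two_ended G e" "set (ends G e) \<inter> {w. joined G S w u} \<noteq> {}"
    then show "set (ends G e) \<subseteq> {w. joined G S w u}"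
      by (auto intro: joined_trans joined_edge)
  qed
  then show ?thesis by simp
qed

text \<open>Serves to erase loops: if a step is to be prepended to a path that already visits its
  start, everything before that visit is dropped.\<close>

lemma walk_path_suffix:
  "walk_path G y P v \<Longrightarrow> x \<in> set (walk_verts G y P) \<Longrightarrow>
   \<exists>P'. walk_path G x P' v \<and> set (walk_verts G x P') \<subseteq> set (walk_verts G y P) \<and>
        walk_edges P' \<subseteq> walk_edges P"
proof (induction P arbitrary: y)
  case Nil
  then show ?case by (intro exI[of _ "[]"]) simp
next
  case (Cons s P)
  obtain e i where s: "s = (e, i)" by fastforce
  show ?case
  proof (cases "x = y")
    case True
    then show ?thesis using Cons.prems by blast
  next
    case False
    have "walk_path G (step_target G s) P v" "x \<in> set (walk_verts G (step_target G s) P)"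
      using Cons.prems s False by (auto simp: walk_path_def)
    then show ?thesis using Cons.IH[of "step_target G s"] by fastforce
  qed
qed

text \<open>The recursion runs along the walk: stop at once if \<open>x\<close> lies in
  \<open>Z\<close>, cut back to a suffix if the path from the next vertex already visits
  \<open>x\<close>, prepend the step otherwise.\<close>

lemma path_to_set:
  assumes "joined G S x z" "z \<in> Z"
  obtains P v where "walk_path G x P v" "walk_edges P \<subseteq> S" "set (walk_verts G x P) \<inter> Z = {v}"
proof -
  have "walk G x W z \<Longrightarrow> walk_edges W \<subseteq> S \<Longrightarrow>
      \<exists>P v. walk_path G x P v \<and> walk_edges P \<subseteq> S \<and> set (walk_verts G x P) \<inter> Z = {v}" for W
  proof (induction W arbitrary: x)
    case Nil
    then show ?case using assms(2) by (intro exI[of _ "[]"]) (auto simp: walk_path_def)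
  next
    case (Cons s W)
    obtain e i where s: "s = (e, i)" by fastforce
    let ?y = "step_target G s"
    obtain P v where P: "walk_path G ?y P v" "walk_edges P \<subseteq> S"
        "set (walk_verts G ?y P) \<inter> Z = {v}"
      using Cons.IH[of ?y] Cons.prems s by auto
    have x: "x \<in> verts G" using Cons.prems walk_end_in_verts by blast
    consider "x \<in> Z" | "x \<notin> Z" "x \<in> set (walk_verts G ?y P)" | "x \<notin> Z" "x \<notin> set (walk_verts G ?y P)"
      by blast
    then show ?case
    proof cases
      case 1
      then show ?thesis using x by (intro exI[of _ "[]"]) (auto simp: walk_path_def)
    next
      case 2
      obtain P' where P': "walk_path G x P' v" "walk_edges P' \<subseteq> walk_edges P"
          "set (walk_verts G x P') \<subseteq> set (walk_verts G ?y P)"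
        using walk_path_suffix[OF P(1) 2(2)] by blast
      \<comment> \<open>The suffix can only lose vertices, but it keeps the end \<open>v\<close>,
        the one vertex in \<open>Z\<close>.\<close>
      moreover have "v \<in> set (walk_verts G x P')"
        using P'(1) walk_end_in_walk_verts unfolding walk_path_def by blast
      ultimately show ?thesis using P by blast
    next
      case 3
      then have "walk_path G x (s # P) v"
        using P Cons.prems s by (auto simp: walk_path_def)
      moreover have "walk_edges (s # P) \<subseteq> S" using P Cons.prems by auto
      moreover have "set (walk_verts G x (s # P)) \<inter> Z = {v}" using P 3 by auto
      ultimately show ?thesis by blast
    qed
  qed
  then show ?thesis using assms(1) that unfolding joined_def by blast
qed

text \<open>The start of each step is missed by the rest of the path, so the edge used is new and
  not a loop.\<close>

lemma walk_path_card:
  "walk_path G u P v \<Longrightarrow>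
   distinct (map fst P) \<and> card (walk_edges P) + 1 = card (set (walk_verts G u P)) \<and>
   (\<forall>e\<in>walk_edges P. distinct (ends G e))"
proof (induction P arbitrary: u)
  case (Cons s P)
  obtain e i where s: "s = (e, i)" by fastforce
  let ?w = "step_target G s"
  have e: "two_ended G e" "i < 2" "ends G e ! i = u" "walk G ?w P v"
    using Cons.prems s by (auto simp: walk_path_def)
  have u: "u \<notin> set (walk_verts G ?w P)" and p: "walk_path G ?w P v"
    using Cons.prems s by (auto simp: walk_path_def)
  have "e \<notin> walk_edges P"
    using u set_walk_verts[OF e(4)] step_ends[OF e(1,2)] e(3) by (auto simp: verts_of_def)
  moreover have "u \<noteq> ?w" using u walk_end_in_walk_verts[OF e(4)] by auto
  then have "distinct (ends G e)"
    using e(2,3) s by (rule_tac two_ended_ends[OF e(1)]) (auto simp: less_2_cases_iff)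
  moreover have "finite (set (walk_verts G ?w P))" by simp
  moreover have "distinct (map fst P)" "card (walk_edges P) + 1 = card (set (walk_verts G ?w P))"
    "\<forall>e\<in>walk_edges P. distinct (ends G e)"
    using Cons.IH[OF p] by auto
  ultimately show ?case using u s by (simp add: walk_edges_def)
qed simp

text \<open>The empty path has a vertex but no edge; \<open>u \<noteq> v\<close> rules it
  out.\<close>

lemma walk_path_verts_of:
  assumes "walk_path G u P v" "u \<noteq> v"
  shows "verts_of G (walk_edges P) = set (walk_verts G u P)"
proof -
  have W: "walk G u P v" using assms by (simp add: walk_path_def)
  obtain e i P' where P: "P = (e, i) # P'" using assms W by (cases P) auto
  have "u \<in> set (ends G e)" using W P step_ends[of e i] by auto
  then have "u \<in> verts_of G (walk_edges P)" using P by (auto simp: verts_of_def)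
  then show ?thesis using set_walk_verts[OF W] by auto
qed

section \<open>Degrees\<close>

lemma finite_edge_set: "S \<subseteq> edges G \<Longrightarrow> finite S"
  by (rule finite_subset[OF _ finite_edges])

lemma verts_of_in_verts: "S \<subseteq> edges G \<Longrightarrow> verts_of G S \<subseteq> verts G"
  using ends_in_verts by (auto simp: verts_of_def)

lemma finite_verts_of: "S \<subseteq> edges G \<Longrightarrow> finite (verts_of G S)"
  by (rule finite_subset[OF verts_of_in_verts finite_verts])

lemma degree_Un_disjoint:
  "finite A \<Longrightarrow> finite B \<Longrightarrow> A \<inter> B = {} \<Longrightarrow> degree G (A \<union> B) v = degree G A v + degree G B v"
  unfolding degree_def by (rule sum.union_disjoint)

lemma degree_eq_0_iff: "finite S \<Longrightarrow> degree G S v = 0 \<longleftrightarrow> v \<notin> verts_of G S"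
  by (simp add: degree_def verts_of_def count_list_0_iff)

lemma sum_degree:
  assumes "\<And>e. e \<in> S \<Longrightarrow> two_ended G e" "verts_of G S \<subseteq> Y" "finite Y"
  shows "(\<Sum>v\<in>Y. degree G S v) = 2 * card S"
proof -
  have "(\<Sum>v\<in>Y. degree G S v) = (\<Sum>e\<in>S. \<Sum>v\<in>Y. count_list (ends G e) v)"
    unfolding degree_def by (rule sum.swap)
  also have "\<dots> = (\<Sum>e\<in>S. 2)"
    using assms by (intro sum.cong sum_count_set[THEN trans])
      (auto simp: two_ended_def verts_of_def)
  finally show ?thesis by simp
qed

text \<open>Each step adds one to the degree at its start and one at its target. For a closed trail
  the two indicators add up to 2 and drop out; otherwise exactly the two ends have odd
  degree.\<close>

lemma trail_degree_parity:
  "walk G u W v \<Longrightarrow> distinct (map fst W) \<Longrightarrow>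
   even (degree G (walk_edges W) z + of_bool (z = u) + of_bool (z = v))"
proof (induction W arbitrary: u)
  case Nil
  then show ?case by (auto simp: degree_def)
next
  case (Cons s W)
  obtain e i where s: "s = (e, i)" by fastforce
  let ?w = "step_target G s"
  have e: "two_ended G e" "i < 2" "ends G e ! i = u"
    using Cons.prems s by auto
  have "e \<notin> walk_edges W" using Cons.prems s by (auto simp: walk_edges_def)
  then have "degree G (walk_edges (s # W)) z = count_list (ends G e) z + degree G (walk_edges W) z"
    using s by (simp add: degree_def)
  moreover have "count_list (ends G e) z = of_bool (z = u) + of_bool (z = ?w)"
    using e(2,3) s by (rule_tac two_ended_ends[OF e(1)]) (auto simp: less_2_cases_iff)
  moreover have "even (degree G (walk_edges W) z + of_bool (z = ?w) + of_bool (z = v))"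
    using Cons.prems s by (intro Cons.IH) simp_all
  ultimately show ?case by (simp only:) (simp add: algebra_simps)
qed

text \<open>
  Otherwise the vertices reached from one end of the trail would contain an odd number of
  vertices of odd degree in the complement of the trail.
\<close>

lemma joined_off_trail:
  assumes C: "\<And>e. e \<in> C \<Longrightarrow> two_ended G e" "\<And>v. even (degree G C v)"
    and W: "walk G x W y" "distinct (map fst W)" "walk_edges W \<subseteq> C"
  shows "joined G (C - walk_edges W) x y"
proof (rule ccontr)
  let ?D = "C - walk_edges W"
  assume n: "\<not> joined G ?D x y"
  define Y where "Y = {v. joined G ?D x v}"
  have CE: "C \<subseteq> edges G" using C(1) by (auto simp: two_ended_def)
  have fin: "finite C" using CE by (rule finite_edge_set)
  have finY: "finite Y" unfolding Y_def
    by (rule finite_subset[OF _ finite_verts]) (use joined_in_verts in blast)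
  have x: "x \<in> Y" "y \<notin> Y" using n W(1) walk_end_in_verts joined_refl by (auto simp: Y_def)
  \<comment> \<open>By the choice of \<open>Y\<close>, an edge of \<open>?D\<close> that meets
    \<open>Y\<close> has all its ends in \<open>Y\<close>; so \<open>A\<close> has the same degrees
    on \<open>Y\<close> as \<open>?D\<close>, and handshaking applies to it.\<close>
  define A where "A = {e \<in> ?D. set (ends G e) \<inter> Y \<noteq> {}}"
  have "set (ends G e) \<subseteq> Y" if "e \<in> A" for e
    using that C(1) joined_edge[of e ?D]
    by (auto simp: A_def Y_def) (metis DiffI joined_trans)
  then have "(\<Sum>v\<in>Y. degree G A v) = 2 * card A"
    using C(1) finY by (intro sum_degree) (auto simp: A_def verts_of_def)
  moreover have "(\<Sum>v\<in>Y. degree G A v) = (\<Sum>v\<in>Y. degree G ?D v)"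
  proof (intro sum.cong refl)
    fix v assume "v \<in> Y"
    have "degree G (A \<union> (?D - A)) v = degree G A v + degree G (?D - A) v"
      using fin by (intro degree_Un_disjoint) (auto simp: A_def)
    moreover have "degree G (?D - A) v = 0"
      using \<open>v \<in> Y\<close> fin by (subst degree_eq_0_iff) (auto simp: A_def verts_of_def)
    moreover have "A \<union> (?D - A) = ?D" by (auto simp: A_def)
    ultimately show "degree G A v = degree G ?D v" by simp
  qed
  moreover have "degree G C v = degree G (walk_edges W) v + degree G ?D v" for v
    using degree_Un_disjoint[of "walk_edges W" ?D v] fin W(3) by (simp add: Un_absorb1)
  then have "(\<Sum>v\<in>Y. degree G C v) =
      (\<Sum>v\<in>Y. degree G (walk_edges W) v) + (\<Sum>v\<in>Y. degree G ?D v)"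
    by (simp add: sum.distrib)
  moreover have "even (\<Sum>v\<in>Y. degree G C v)" using C(2) by (simp add: dvd_sum)
  moreover have "even (\<Sum>v\<in>Y. degree G (walk_edges W) v + of_bool (v = x) + of_bool (v = y))"
    using trail_degree_parity[OF W(1,2)] by (simp add: dvd_sum)
  moreover have "(\<Sum>v\<in>Y. degree G (walk_edges W) v + of_bool (v = x) + of_bool (v = y)) =
      (\<Sum>v\<in>Y. degree G (walk_edges W) v) + 1"
    using x finY by (simp add: sum.distrib of_bool_def sum.delta)
  \<comment> \<open>Here \<open>a\<close>, \<open>b\<close>, \<open>c\<close>, \<open>w\<close> are
    the degree sums over \<open>Y\<close> of \<open>A\<close>, \<open>?D\<close>, \<open>C\<close>
    and the trail. Since just one end of the trail lies in \<open>Y\<close>, the sum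
    \<open>w\<close> is odd, whereas \<open>b\<close> and \<open>c\<close> are even.\<close>
  moreover have False if "a = 2 * k" "a = b" "c = w + b" "even c" "even s" "s = w + 1"
    for a b c w s k :: nat
    using that by presburger
  ultimately show False by blast
qed

section \<open>Connected subgraphs and circles\<close>

text \<open>The exception is an isolated vertex, which cannot be recovered from its edges.\<close>

lemma connected_subgraph_nonempty_verts:
  assumes "connected_subgraph G X T" "verts_of G T \<noteq> {}"
  shows "verts_of G T = X"
proof (rule antisym)
  show "verts_of G T \<subseteq> X" using assms by (simp add: connected_subgraph_def)
  show "X \<subseteq> verts_of G T"
  proof
    fix v assume "v \<in> X"
    obtain u where u: "u \<in> verts_of G T" using assms by blast
    then have "joined G T u v"
      using assms(1) \<open>v \<in> X\<close> unfolding connected_subgraph_def by blast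
    then show "v \<in> verts_of G T"
      using u by (rule joined_closed) (auto simp: verts_of_def)
  qed
qed

lemma finite_connected:
  assumes "connected_subgraph G X T"
  shows "finite X" "finite T"
  using assms finite_subset[OF _ finite_verts] finite_subset[OF _ finite_edges]
  by (auto simp: connected_subgraph_def)

lemma connected_subgraph_joinedI:
  assumes "u \<in> X" "X \<subseteq> verts G" "S \<subseteq> edges G" "verts_of G S \<subseteq> X"
    and "\<And>v. v \<in> X \<Longrightarrow> joined G S u v"
  shows "connected_subgraph G X S"
proof -
  have "joined G S v w" if "v \<in> X" "w \<in> X" for v w
    by (rule joined_trans[OF joined_sym]) (rule assms(5)[OF that(1)], rule assms(5)[OF that(2)])
  then show ?thesis using assms unfolding connected_subgraph_def by auto
qed

lemma crossing_edge:
  assumes "joined G T u v" "u \<in> Y" "v \<notin> Y"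
  obtains e a b where "e \<in> T" "two_ended G e" "a \<in> set (ends G e)" "b \<in> set (ends G e)"
    "a \<in> Y" "b \<notin> Y"
proof -
  have "\<not> (\<forall>e. e \<in> T \<longrightarrow> two_ended G e \<longrightarrow> set (ends G e) \<inter> Y \<noteq> {} \<longrightarrow> set (ends G e) \<subseteq> Y)"
    using joined_closed[OF assms(1,2)] assms(3) by blast
  then show ?thesis using that by blast
qed

text \<open>Grow \<open>Z\<close> to \<open>X\<close> one vertex at a time: each step uses a new edge.\<close>

lemma card_diff_le_edges:
  assumes T: "connected_subgraph G X T"
    and Z: "Z \<subseteq> X" "Z \<noteq> {}" and D: "D \<subseteq> T" "verts_of G D \<subseteq> Z"
  shows "card (X - Z) \<le> card (T - D)"
proof -
  note fin = finite_connected[OF T]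
  \<comment> \<open>This is the spanning tree bound after contracting \<open>Z\<close> to a point.
    Counting only edges inside \<open>Y\<close> and outside \<open>D\<close> makes each crossing
    edge a new one.\<close>
  have "n \<le> card (X - Z) \<Longrightarrow>
    \<exists>Y. Z \<subseteq> Y \<and> Y \<subseteq> X \<and> card (Y - Z) = n \<and> n \<le> card {e \<in> T - D. set (ends G e) \<subseteq> Y}" for n
  proof (induction n)
    case 0
    then show ?case using Z(1) by (intro exI[of _ Z]) auto
  next
    case (Suc n)
    then obtain Y where Y: "Z \<subseteq> Y" "Y \<subseteq> X" "card (Y - Z) = n"
        "n \<le> card {e \<in> T - D. set (ends G e) \<subseteq> Y}"
      by auto
    have "Y \<noteq> X" using Suc.prems Y(3) by auto
    then obtain v where v: "v \<in> X" "v \<notin> Y" using Y by auto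
    obtain u where u: "u \<in> Z" using Z by auto
    have "joined G T u v" using T u v Z(1) unfolding connected_subgraph_def by blast
    then obtain e a b where e: "e \<in> T" "two_ended G e" "a \<in> set (ends G e)" "b \<in> set (ends G e)"
        "a \<in> Y" "b \<notin> Y"
      using crossing_edge[of T u v Y] u v Y(1) by blast
    have ab: "set (ends G e) = {a, b}"
      using e by (rule_tac two_ended_ends[OF e(2)]) auto
    have eD: "e \<notin> D" using e D(2) Y(1) by (auto simp: verts_of_def)
    have b: "b \<in> X" using T e by (auto simp: connected_subgraph_def verts_of_def)
    have "card (insert e {e \<in> T - D. set (ends G e) \<subseteq> Y}) \<le>
        card {e \<in> T - D. set (ends G e) \<subseteq> insert b Y}"
      using fin ab e eD by (intro card_mono) auto
    moreover have "card (insert e {e \<in> T - D. set (ends G e) \<subseteq> Y}) =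
        Suc (card {e \<in> T - D. set (ends G e) \<subseteq> Y})"
      using fin ab e by (intro card_insert_disjoint) auto
    ultimately have "Suc n \<le> card {e \<in> T - D. set (ends G e) \<subseteq> insert b Y}" using Y(4) by simp
    moreover have "insert b Y - Z = insert b (Y - Z)" using e(6) Y(1) by auto
    then have "card (insert b Y - Z) = Suc n"
      using e(6) Y(2,3) fin finite_subset[of Y X] by simp
    ultimately show ?case using Y b by (intro exI[of _ "insert b Y"]) auto
  qed
  from this[of "card (X - Z)"] obtain Y
    where "card (X - Z) \<le> card {e \<in> T - D. set (ends G e) \<subseteq> Y}" by auto
  also have "\<dots> \<le> card (T - D)" using fin by (intro card_mono) auto
  finally show ?thesis .
qed

lemma card_le_edges_Suc:
  assumes "connected_subgraph G X T"
  shows "card X \<le> card T + 1"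
proof -
  obtain u where u: "u \<in> X" using assms unfolding connected_subgraph_def by blast
  have "card (X - {u}) \<le> card (T - {})"
    using u assms by (intro card_diff_le_edges) auto
  then show ?thesis using u finite_connected[OF assms] by simp
qed

section \<open>Deletion of an edge whose ends stay joined\<close>

lemma joined_delete_edge:
  assumes "joined G T u v"
    and "\<And>a b. two_ended G e \<Longrightarrow> a \<in> set (ends G e) \<Longrightarrow> b \<in> set (ends G e) \<Longrightarrow>
          joined G (T - {e}) a b"
  shows "joined G (T - {e}) u v"
proof -
  have "v \<in> {w. joined G (T - {e}) u w}"
  proof (rule joined_closed[OF assms(1)])
    show "u \<in> {w. joined G (T - {e}) u w}" using assms(1) joined_in_verts joined_refl by auto
  next
    fix f assume f: "f \<in> T" "two_ended G f" "set (ends G f) \<inter> {w. joined G (T - {e}) u w} \<noteq> {}"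
    have "joined G (T - {e}) a b" if "a \<in> set (ends G f)" "b \<in> set (ends G f)" for a b
      using assms(2)[of a b] joined_edge[of f "T - {e}" a b] f that by (cases "f = e") auto
    then show "set (ends G f) \<subseteq> {w. joined G (T - {e}) u w}"
      using f(3) joined_trans by blast
  qed
  then show ?thesis by simp
qed

text \<open>For a half edge or a loose edge the condition is vacuous, as such edges join
  nothing.\<close>

lemma connected_delete_edge:
  assumes "connected_subgraph G X T"
    and "\<And>a b. two_ended G e \<Longrightarrow> a \<in> set (ends G e) \<Longrightarrow> b \<in> set (ends G e) \<Longrightarrow>
          joined G (T - {e}) a b"
  shows "connected_subgraph G X (T - {e})"
  using assms joined_delete_edge[OF _ assms(2)] verts_of_mono[of "T - {e}" T G]
  unfolding connected_subgraph_def by blast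

text \<open>A minimal set \<open>C\<close> of this kind is a circle: deleting an edge shows that
  edges and vertices are equally many, deleting a pendant vertex that degrees are at least 2,
  handshaking that they equal 2; and if \<open>C\<close> were disconnected, both parts would have
  fewer edges than vertices.\<close>

lemma contains_circle:
  assumes "U \<noteq> {}" "\<And>e. e \<in> U \<Longrightarrow> two_ended G e" "card (verts_of G U) \<le> card U"
  shows "\<exists>C. C \<subseteq> U \<and> circle G C"
proof -
  define good where "good U \<longleftrightarrow> U \<noteq> {} \<and> (\<forall>e\<in>U. two_ended G e) \<and> card (verts_of G U) \<le> card U" for U
  have fin: "finite U" "finite (verts_of G U)" if "\<forall>e\<in>U. two_ended G e" for U
    using that finite_edge_set[of U] finite_verts_of[of U] by (auto simp: two_ended_def)
  have "good U" using assms by (simp add: good_def)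
  then have "\<exists>C. (C \<subseteq> U \<and> good C) \<and> (\<forall>B. B \<subseteq> U \<and> good B \<longrightarrow> card C \<le> card B)"
    by (intro ex_has_least_nat[of _ U]) simp
  then obtain C where C: "C \<subseteq> U" "good C" and least: "\<And>B. B \<subseteq> U \<Longrightarrow> good B \<Longrightarrow> card C \<le> card B"
    by blast
  have min: "B = C" if "B \<subseteq> C" "good B" for B
    using that C fin(1)[of C] least[of B] by (intro card_seteq) (auto simp: good_def)
  have te: "\<And>e. e \<in> C \<Longrightarrow> two_ended G e" and ne: "C \<noteq> {}"
    and le: "card (verts_of G C) \<le> card C"
    using C by (auto simp: good_def)
  have finC: "finite C" "finite (verts_of G C)" using fin te by auto
  have CE: "C \<subseteq> edges G" using te by (auto simp: two_ended_def)
  have smaller: "card B < card (verts_of G B)" if "B \<subset> C" "B \<noteq> {}" for B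
  proof (rule ccontr)
    assume "\<not> card B < card (verts_of G B)"
    then have "good B" using that te by (auto simp: good_def)
    then show False using min[of B] that by blast
  qed
  have Vne: "verts_of G C \<noteq> {}"
  proof -
    obtain e where e: "e \<in> C" using ne by auto
    then obtain a b where "ends G e = [a, b]" using te two_ended_ends by blast
    then show ?thesis using e by (force simp: verts_of_def)
  qed
  have eq: "card C = card (verts_of G C)"
  proof (rule antisym[OF _ le], rule ccontr)
    assume "\<not> card C \<le> card (verts_of G C)"
    obtain e where e: "e \<in> C" using ne by auto
    have "card (verts_of G C) > 0" using Vne finC by (simp add: card_gt_0_iff)
    then have "card C \<noteq> 1" using \<open>\<not> card C \<le> card (verts_of G C)\<close> by simp
    then have "C \<noteq> {e}" by auto
    then have "C - {e} \<noteq> {}" using e by blast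
    then have "card (C - {e}) < card (verts_of G (C - {e}))" using e by (intro smaller) auto
    also have "\<dots> \<le> card (verts_of G C)" using finC by (intro card_mono verts_of_mono) auto
    finally show False using \<open>\<not> card C \<le> card (verts_of G C)\<close> e finC by simp
  qed
  have deg2: "2 \<le> degree G C v" if v: "v \<in> verts_of G C" for v
  proof (rule ccontr)
    assume "\<not> 2 \<le> degree G C v"
    moreover have "degree G C v \<noteq> 0" using v finC by (subst degree_eq_0_iff) auto
    ultimately have 1: "degree G C v = 1" by simp
    obtain e where e: "e \<in> C" "v \<in> set (ends G e)" using v by (auto simp: verts_of_def)
    have "degree G C v = count_list (ends G e) v + degree G (C - {e}) v"
      unfolding degree_def using finC e by (intro sum.remove) auto
    moreover have "count_list (ends G e) v \<noteq> 0" using e by (simp add: count_list_0_iff)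
    \<comment> \<open>Degree 1 means that \<open>e\<close> is not a loop and is the only edge at
      \<open>v\<close>, so deleting \<open>e\<close> also removes \<open>v\<close>.\<close>
    ultimately have d: "count_list (ends G e) v = 1" "degree G (C - {e}) v = 0" using 1 by auto
    then have v': "v \<notin> verts_of G (C - {e})" using finC degree_eq_0_iff[of "C - {e}" v] by simp
    show False
    proof (cases "C = {e}")
      case True
      obtain a b where "ends G e = [a, b]" using two_ended_ends te e by blast
      then have "card (verts_of G C) = 2"
        using True d e by (auto simp: verts_of_def card_insert_if split: if_splits)
      then show False using eq True by simp
    next
      case False
      then have "card (C - {e}) < card (verts_of G (C - {e}))" using e by (intro smaller) auto
      also have "\<dots> \<le> card (verts_of G C - {v})"
        using finC v' verts_of_mono[of "C - {e}" C G] by (intro card_mono) auto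
      also have "\<dots> = card (verts_of G C) - 1" using v finC by simp
      finally show False using eq e finC by simp
    qed
  qed
  \<comment> \<open>The average degree is 2, so the lower bound 2 is attained at every
    vertex.\<close>
  have "(\<Sum>v\<in>verts_of G C. degree G C v) = (\<Sum>v\<in>verts_of G C. 2)"
    using sum_degree[of C "verts_of G C"] te finC eq by simp
  then have deg: "\<forall>v\<in>verts_of G C. 2 = degree G C v"
    using sum_mono_inv[of "\<lambda>_. 2" "verts_of G C" "degree G C"] deg2 finC by auto
  obtain u where u: "u \<in> verts_of G C" using Vne by auto
  have "connected_subgraph G (verts_of G C) C"
  proof (rule connected_subgraph_joinedI[OF u])
    show "verts_of G C \<subseteq> verts G" using CE by (rule verts_of_in_verts)
  next
    fix v assume v: "v \<in> verts_of G C"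
    define Y where "Y = {w. joined G C u w}"
    define A where "A = {e \<in> C. set (ends G e) \<subseteq> Y}"
    have cl: "set (ends G e) \<inter> Y = {}" if "e \<in> C - A" for e
    proof -
      have "set (ends G e) \<subseteq> Y" if "set (ends G e) \<inter> Y \<noteq> {}"
        using that \<open>e \<in> C - A\<close> te[of e] joined_edge[of e C] joined_trans[of C u]
        unfolding Y_def by blast
      then show ?thesis using that by (auto simp: A_def)
    qed
    have "u \<in> Y" using u verts_of_in_verts[OF CE] joined_refl[of u C] by (auto simp: Y_def)
    then obtain e where e: "e \<in> C" "u \<in> set (ends G e)" using u by (auto simp: verts_of_def)
    then have "A \<noteq> {}" using cl[of e] \<open>u \<in> Y\<close> by blast
    have "C = A"
    proof (rule ccontr)
      assume "C \<noteq> A"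
      have "A \<subseteq> C" by (auto simp: A_def)
      \<comment> \<open>Both parts are nonempty proper subsets of \<open>C\<close>, so minimality
        applies to each; adding up contradicts \<open>eq\<close>.\<close>
      have "card A < card (verts_of G A)" "card (C - A) < card (verts_of G (C - A))"
        using \<open>A \<noteq> {}\<close> \<open>C \<noteq> A\<close> \<open>A \<subseteq> C\<close> by (auto intro!: smaller)
      moreover have "verts_of G A \<inter> verts_of G (C - A) = {}"
        using cl by (fastforce simp: verts_of_def A_def)
      then have "card (verts_of G A \<union> verts_of G (C - A)) = card (verts_of G A) + card (verts_of G (C - A))"
        using finite_verts_of[of A] finite_verts_of[of "C - A"] CE \<open>A \<subseteq> C\<close>
        by (intro card_Un_disjoint) auto
      moreover have "verts_of G A \<union> verts_of G (C - A) = verts_of G C"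
        using \<open>A \<subseteq> C\<close> by (auto simp: verts_of_def)
      moreover have "card C = card A + card (C - A)"
        using \<open>A \<subseteq> C\<close> finC by (metis card_Diff_subset card_mono finite_subset le_add_diff_inverse)
      ultimately show False using eq by simp
    qed
    then have "v \<in> Y" using v by (auto simp: A_def verts_of_def)
    then show "joined G C u v" by (simp add: Y_def)
  qed (use CE in auto)
  then have "circle G C" using te deg by (auto simp: circle_def)
  then show ?thesis using C by blast
qed

text \<open>An even degree is at least 2 at every covered vertex, so handshaking yields the count
  required by \<open>contains_circle\<close>.\<close>

lemma even_degree_contains_circle:
  assumes "U \<noteq> {}" "\<And>e. e \<in> U \<Longrightarrow> two_ended G e" "\<And>v. even (degree G U v)"
  shows "\<exists>C. C \<subseteq> U \<and> circle G C"
proof (rule contains_circle[OF assms(1,2)])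
  have U: "U \<subseteq> edges G" using assms(2) by (auto simp: two_ended_def)
  note fin = finite_edge_set[OF U] finite_verts_of[OF U]
  have "2 \<le> degree G U v" if "v \<in> verts_of G U" for v
    using that assms(3)[of v] degree_eq_0_iff[OF fin(1), of v]
    by (cases "degree G U v = 1") auto
  then have "(\<Sum>v\<in>verts_of G U. 2) \<le> (\<Sum>v\<in>verts_of G U. degree G U v)" by (intro sum_mono)
  then show "card (verts_of G U) \<le> card U"
    using sum_degree[of U "verts_of G U"] assms(2) fin by simp
qed

section \<open>Figures: circles and half edges\<close>

lemma circle_two_ended: "circle G C \<Longrightarrow> e \<in> C \<Longrightarrow> two_ended G e"
  by (simp add: circle_def)

lemma circle_edges: "circle G C \<Longrightarrow> C \<subseteq> edges G"
  by (auto simp: circle_def two_ended_def)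

lemma circle_nonempty: "circle G C \<Longrightarrow> C \<noteq> {}"
  by (auto simp: circle_def connected_subgraph_def)

lemma circle_even_degree: "circle G C \<Longrightarrow> even (degree G C v)"
  using degree_eq_0_iff[OF finite_edge_set[OF circle_edges], of C v]
  by (cases "v \<in> verts_of G C") (auto simp: circle_def)

lemma circle_card: "circle G C \<Longrightarrow> card C = card (verts_of G C)"
  using sum_degree[of C "verts_of G C"] finite_verts_of[OF circle_edges, of C]
  by (auto simp: circle_def)

lemma figure_edges: "figure G F \<Longrightarrow> F \<subseteq> edges G"
  using circle_edges by (auto simp: figure_def half_edge_def)

lemma figure_card: "figure G F \<Longrightarrow> card F = card (verts_of G F)"
  unfolding figure_def using circle_card
  by (auto elim!: half_edge_ends simp: verts_of_def)

lemma figure_connected: "figure G F \<Longrightarrow> connected_subgraph G (verts_of G F) F"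
  unfolding figure_def
proof (elim disjE exE conjE)
  fix h assume h: "half_edge G h" "F = {h}"
  then obtain a where "ends G h = [a]" "a \<in> verts G" using half_edge_ends by blast
  then show ?thesis using h joined_refl
    by (auto simp: connected_subgraph_def verts_of_def half_edge_def)
qed (simp add: circle_def)

lemma figure_nonempty: "figure G F \<Longrightarrow> F \<noteq> {} \<and> verts_of G F \<noteq> {}"
  using figure_connected unfolding connected_subgraph_def by (auto simp: verts_of_def)

lemma negative_figure_figure: "negative_figure G F \<Longrightarrow> figure G F"
  by (auto simp: negative_figure_def figure_def negative_circle_def)

text \<open>\<open>C\<close> already uses up the degree 2 at each of its vertices, so the other
  edges of \<open>C'\<close> avoid these vertices; connectedness of \<open>C'\<close> leaves no such
  edge.\<close>

lemma circle_subset_eq: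
  assumes "circle G C" "circle G C'" "C \<subseteq> C'"
  shows "C = C'"
proof -
  have fin: "finite C'" using finite_edge_set[OF circle_edges] assms(2) by blast
  have no: "set (ends G e) \<inter> verts_of G C = {}" if "e \<in> C' - C" for e
  proof -
    have "degree G (C \<union> (C' - C)) v = degree G C v + degree G (C' - C) v" for v
      using fin finite_subset[OF assms(3) fin] by (intro degree_Un_disjoint) auto
    moreover have "C \<union> (C' - C) = C'" using assms(3) by auto
    moreover have "degree G C v = 2" "degree G C' v = 2" if "v \<in> verts_of G C" for v
      using assms(1,2) that subsetD[OF verts_of_mono[OF assms(3)] that] by (auto simp: circle_def)
    ultimately have "degree G (C' - C) v = 0" if "v \<in> verts_of G C" for v
      using that by (metis add_cancel_left_right)
    then show ?thesis using that fin degree_eq_0_iff[of "C' - C"] by (auto simp: verts_of_def)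
  qed
  have "e \<in> C" if e: "e \<in> C'" for e
  proof -
    obtain a b where ab: "ends G e = [a, b]"
      by (rule two_ended_ends[OF circle_two_ended[OF assms(2) e]])
    obtain u where u: "u \<in> verts_of G C" using figure_nonempty[of C] assms(1) by (auto simp: figure_def)
    have "a \<in> verts_of G C'" using ab e by (force simp: verts_of_def)
    moreover have "u \<in> verts_of G C'" using u verts_of_mono[OF assms(3), of G] by auto
    ultimately have "joined G C' u a"
      using assms(2) by (simp add: circle_def connected_subgraph_def)
    then have "a \<in> verts_of G C"
    proof (rule joined_closed)
      fix f assume "f \<in> C'" "set (ends G f) \<inter> verts_of G C \<noteq> {}"
      then have "f \<in> C" using no[of f] by blast
      then show "set (ends G f) \<subseteq> verts_of G C" by (auto simp: verts_of_def)
    qed (rule u)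
    then show ?thesis using no[of e] e ab by auto
  qed
  then show ?thesis using assms(3) by blast
qed

lemma figure_subset_eq:
  assumes "figure G F" "figure G F'" "F \<subseteq> F'"
  shows "F = F'"
proof (cases "circle G F")
  case True
  then obtain e where "e \<in> F" "two_ended G e" using circle_nonempty circle_two_ended by blast
  then have "circle G F'" using assms(2,3) not_half_two_ended by (auto simp: figure_def)
  then show ?thesis using circle_subset_eq True assms(3) by blast
next
  case False
  then obtain h where h: "half_edge G h" "F = {h}" using assms(1) by (auto simp: figure_def)
  then have "\<not> circle G F'" using assms(3) circle_two_ended not_half_two_ended by blast
  then show ?thesis using h assms(2,3) by (auto simp: figure_def)
qed

text \<open>A single edge of a circle is a trail, so \<open>joined_off_trail\<close> connects its
  ends through the rest of the circle; a half edge joins nothing.\<close>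

lemma connected_delete_figure_edge:
  assumes "connected_subgraph G X T" "figure G F" "F \<subseteq> T" "e \<in> F"
  shows "connected_subgraph G X (T - {e})"
proof (rule connected_delete_edge[OF assms(1)])
  fix a b assume e: "two_ended G e" "a \<in> set (ends G e)" "b \<in> set (ends G e)"
  then have F: "circle G F" using assms not_half_two_ended by (auto simp: figure_def)
  obtain x y where xy: "ends G e = [x, y]" by (rule two_ended_ends[OF e(1)])
  have "joined G (F - walk_edges [(e, 0)]) x y"
    using walk_edge(1)[OF e(1) xy] assms(4) circle_two_ended[OF F] circle_even_degree[OF F]
    by (intro joined_off_trail) auto
  then have "joined G (T - {e}) x y" using assms(3) by (auto elim: joined_mono)
  then show "joined G (T - {e}) a b"
    using e xy joined_sym joined_refl joined_in_verts by auto
qed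

section \<open>Counting edges and figures\<close>

text \<open>Contracting the figure in \<open>card_diff_le_edges\<close> removes equally many edges
  and vertices.\<close>

lemma figure_card_le:
  assumes T: "connected_subgraph G X T" and F: "figure G F" "F \<subseteq> T"
  shows "card X \<le> card T"
proof -
  note fin = finite_connected[OF T]
  have VX: "verts_of G F \<subseteq> X"
    using T verts_of_mono[OF F(2), of G] by (auto simp: connected_subgraph_def)
  have "card (X - verts_of G F) \<le> card (T - F)"
    using figure_nonempty[OF F(1)] F(2) VX by (intro card_diff_le_edges[OF T]) auto
  moreover have "card (T - F) = card T - card F" "card F \<le> card T"
    using F(2) fin finite_subset[OF F(2)] by (auto simp: card_Diff_subset card_mono)
  moreover have "card (X - verts_of G F) = card X - card (verts_of G F)"
    using VX fin finite_subset[OF VX] by (intro card_Diff_subset) auto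
  ultimately show ?thesis using figure_card[OF F(1)] by linarith
qed

lemma figure_not_subset:
  assumes "figure G F" "figure G F'" "F \<noteq> F'"
  obtains e where "e \<in> F" "e \<notin> F'"
  using figure_subset_eq[OF assms(1,2)] assms(3) by blast

text \<open>No figure properly contains another, so \<open>F\<close> has an edge outside
  \<open>F'\<close>; after its deletion \<open>F'\<close> still forces \<open>card X\<close>
  edges.\<close>

lemma two_figures_card_less:
  assumes T: "connected_subgraph G X T"
    and F: "figure G F" "F \<subseteq> T" "figure G F'" "F' \<subseteq> T" "F \<noteq> F'"
  shows "card X < card T"
proof -
  obtain e where e: "e \<in> F" "e \<notin> F'" using figure_not_subset F by metis
  have "connected_subgraph G X (T - {e})"
    using connected_delete_figure_edge[OF T F(1,2) e(1)] .
  then have "card X \<le> card (T - {e})"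
    by (rule figure_card_le[OF _ F(3)]) (use F(4) e in auto)
  also have "\<dots> < card T" using e F(2) finite_connected[OF T] by (intro psubset_card_mono) auto
  finally show ?thesis .
qed

text \<open>Deleting an edge that avoids \<open>F1\<close> and \<open>F2\<close> would leave a
  connected graph with two figures, hence with more than \<open>card X\<close> edges.\<close>

lemma three_figures_edge:
  assumes T: "connected_subgraph G X T" "card T \<le> card X + 1"
    and F: "figure G F" "F \<subseteq> T" "e \<in> F"
    and F': "figure G F1" "F1 \<subseteq> T" "figure G F2" "F2 \<subseteq> T" "F1 \<noteq> F2"
  shows "e \<in> F1 \<or> e \<in> F2"
proof (rule ccontr)
  assume "\<not> (e \<in> F1 \<or> e \<in> F2)"
  then have "card X < card (T - {e})"
    using F' by (intro two_figures_card_less[OF connected_delete_figure_edge[OF T(1) F], of F1 F2]) auto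
  moreover have "card (T - {e}) < card T"
    using F finite_connected[OF T(1)] by (intro psubset_card_mono) auto
  ultimately show False using T(2) by simp
qed

text \<open>An edge of \<open>F1\<close> outside \<open>F3\<close> can only lie in
  \<open>F2\<close>.\<close>

lemma three_figures_inter:
  assumes T: "connected_subgraph G X T" "card T \<le> card X + 1"
    and F: "figure G F1" "F1 \<subseteq> T" "figure G F2" "F2 \<subseteq> T" "figure G F3" "F3 \<subseteq> T"
    and ne: "F1 \<noteq> F2" "F1 \<noteq> F3" "F2 \<noteq> F3"
  shows "F1 \<inter> F2 \<noteq> {}"
proof -
  obtain e where "e \<in> F1" "e \<notin> F3" using figure_not_subset F ne by metis
  then show ?thesis using three_figures_edge[OF T F(1,2) _ F(3,4,5,6) ne(3)] by blast
qed

text \<open>In general a symmetric difference of circles only decomposes into edge-disjoint circles;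
  the bound on \<open>T\<close> excludes a second one.\<close>

lemma circle_sym_diff:
  assumes T: "connected_subgraph G X T" "card T \<le> card X + 1"
    and C: "circle G C1" "C1 \<subseteq> T" "circle G C2" "C2 \<subseteq> T" "C1 \<noteq> C2" "C1 \<inter> C2 \<noteq> {}"
  shows "circle G ((C1 - C2) \<union> (C2 - C1))" (is "circle G ?K")
proof -
  have fig: "figure G C1" "figure G C2" using C by (auto simp: figure_def)
  have fin: "finite C1" "finite C2" using C finite_connected[OF T(1)] finite_subset by auto
  have even_diff: "even (degree G (A - B) v)"
    if "finite A" "B \<subseteq> A" "even (degree G A v)" "even (degree G B v)" for A B v
    using degree_Un_disjoint[of B "A - B" v] finite_subset[OF that(2,1)] that
    by (simp add: Un_absorb1)
  have ev: "even (degree G ?K v)" for v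
  proof -
    have "degree G ?K v = degree G (C1 - C2) v + degree G (C2 - C1) v"
      using fin by (intro degree_Un_disjoint) auto
    moreover have "degree G ((C1 - C2) \<union> (C1 \<inter> C2)) v = degree G (C1 - C2) v + degree G (C1 \<inter> C2) v"
      using fin by (intro degree_Un_disjoint) auto
    moreover have "degree G ((C2 - C1) \<union> (C1 \<inter> C2)) v = degree G (C2 - C1) v + degree G (C1 \<inter> C2) v"
      using fin by (intro degree_Un_disjoint) auto
    moreover have "(C1 - C2) \<union> (C1 \<inter> C2) = C1" "(C2 - C1) \<union> (C1 \<inter> C2) = C2" by auto
    moreover have "even (degree G C1 v)" "even (degree G C2 v)" using C circle_even_degree by auto
    ultimately show ?thesis by simp
  qed
  have te: "two_ended G e" if "e \<in> ?K" for e using that C circle_two_ended by blast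
  obtain e where "e \<in> C1" "e \<notin> C2" using figure_not_subset[OF fig C(5)] .
  then have "?K \<noteq> {}" by auto
  then obtain K where K: "K \<subseteq> ?K" "circle G K"
    using even_degree_contains_circle[of ?K] te ev by blast
  have figK: "figure G K" using K by (simp add: figure_def)
  \<comment> \<open>\<open>K\<close> avoids the common edges of \<open>C1\<close> and
    \<open>C2\<close>, while both circles contain them.\<close>
  have neK: "K \<noteq> C1" "K \<noteq> C2" using K(1) C(6) by auto
  have "K = ?K"
  proof (rule ccontr)
    assume "K \<noteq> ?K"
    \<comment> \<open>The remainder still has even degrees, so it contains a circle edge-disjoint
      from \<open>K\<close>; with \<open>C1\<close> as third figure the two would have to share an
      edge.\<close>
    then have "?K - K \<noteq> {}" using K by auto
    moreover have "even (degree G (?K - K) v)" for v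
      using fin K ev circle_even_degree by (intro even_diff) auto
    ultimately obtain K' where K': "K' \<subseteq> ?K - K" "circle G K'"
      using even_degree_contains_circle[of "?K - K"] te by auto
    have figK': "figure G K'" using K' by (simp add: figure_def)
    have "K' \<noteq> C1" using K'(1) C(6) by auto
    moreover have "K \<noteq> K'" using K' circle_nonempty by blast
    moreover have "K \<subseteq> T" "K' \<subseteq> T" using K K' C(2,4) by auto
    ultimately have "K \<inter> K' \<noteq> {}"
      using neK C(2) by (intro three_figures_inter[OF T figK _ figK' _ fig(1)])
    then show False using K' by auto
  qed
  then show ?thesis using K by simp
qed

text \<open>A half edge is a figure; if there is none, all edges are two-ended and
  \<open>contains_circle\<close> applies to the whole of \<open>T\<close>.\<close>

lemma contains_figure:
  assumes T: "connected_subgraph G X T" and no_loose: "\<And>e. e \<in> T \<Longrightarrow> \<not> loose_edge G e"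
    and card: "card X \<le> card T"
  shows "\<exists>F. figure G F \<and> F \<subseteq> T"
proof (cases "\<exists>h\<in>T. half_edge G h")
  case True
  then show ?thesis unfolding figure_def by blast
next
  case False
  have "T \<subseteq> edges G" using T by (simp add: connected_subgraph_def)
  then have te: "two_ended G e" if "e \<in> T" for e
    using that False no_loose edge_cases by blast
  have "card X > 0"
    using T finite_connected[OF T] by (auto simp: connected_subgraph_def card_gt_0_iff)
  then have "T \<noteq> {}" using card by auto
  moreover have "verts_of G T \<subseteq> X" using T by (simp add: connected_subgraph_def)
  then have "card (verts_of G T) \<le> card T"
    using card card_mono[OF finite_connected(1)[OF T]] le_trans by blast
  ultimately have "\<exists>C\<subseteq>T. circle G C" using te by (intro contains_circle) auto
  then show ?thesis by (auto simp: figure_def)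
qed

section \<open>Trees characterized by their number of edges\<close>

lemma tree_card:
  assumes "tree G X T"
  shows "card X = card T + 1"
proof (rule antisym)
  have T: "connected_subgraph G X T" using assms by (simp add: tree_def)
  show "card X \<le> card T + 1" by (rule card_le_edges_Suc[OF T])
  have "\<not> (\<exists>F. figure G F \<and> F \<subseteq> T)"
    using assms not_half_two_ended unfolding tree_def figure_def by blast
  moreover have "\<not> loose_edge G e" if "e \<in> T" for e
    using that assms by (auto simp: tree_def two_ended_def loose_edge_def)
  ultimately have "\<not> card X \<le> card T" using contains_figure[OF T] by blast
  then show "card T + 1 \<le> card X" by simp
qed

lemma treeI:
  assumes T: "connected_subgraph G X T" and no_loose: "\<And>e. e \<in> T \<Longrightarrow> \<not> loose_edge G e"
    and card: "card T < card X"
  shows "tree G X T"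
proof -
  have no: "\<not> (figure G F \<and> F \<subseteq> T)" for F using figure_card_le[OF T] card by fastforce
  have "T \<subseteq> edges G" using T by (simp add: connected_subgraph_def)
  then have "two_ended G e" if "e \<in> T" for e
    using that no[of "{e}"] no_loose[OF that] edge_cases[of e] by (auto simp: figure_def)
  then show ?thesis using T no by (auto simp: tree_def figure_def)
qed

section \<open>Components\<close>

lemma graph_componentE:
  assumes "(X, T) \<in> graph_components G S"
  obtains u where "u \<in> verts G" "X = {v \<in> verts G. joined G S u v}" "T = edges_at G S X" "u \<in> X"
  using assms joined_refl by (auto simp: graph_components_def Let_def)

lemma graph_component_eq:
  assumes "(X, T) \<in> graph_components G S" "(X', T') \<in> graph_components G S" "v \<in> X" "v \<in> X'"
  shows "X = X' \<and> T = T'"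
proof -
  obtain u where u: "X = {v \<in> verts G. joined G S u v}" "T = edges_at G S X"
    using assms(1) by (rule graph_componentE)
  obtain u' where u': "X' = {v \<in> verts G. joined G S u' v}" "T' = edges_at G S X'"
    using assms(2) by (rule graph_componentE)
  have v: "joined G S u v" "joined G S u' v" using assms u u' by auto
  have "joined G S u w \<longleftrightarrow> joined G S u' w" for w
    using joined_trans[OF joined_trans[OF v(1) joined_sym[OF v(2)]]]
      joined_trans[OF joined_trans[OF v(2) joined_sym[OF v(1)]]] by blast
  then show ?thesis using u u' by simp
qed

lemma graph_component_closed:
  assumes "S \<subseteq> edges G" "(X, T) \<in> graph_components G S" "e \<in> S" "set (ends G e) \<inter> X \<noteq> {}"
  shows "e \<in> T \<and> set (ends G e) \<subseteq> X"
proof -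
  obtain u where u: "X = {v \<in> verts G. joined G S u v}" "T = edges_at G S X"
    using assms(2) by (rule graph_componentE)
  have e: "e \<in> edges G" using assms by auto
  have "set (ends G e) \<subseteq> X"
  proof (cases "two_ended G e")
    case True
    obtain a where a: "a \<in> set (ends G e)" "joined G S u a" using assms(4) u by auto
    have "joined G S u b" if "b \<in> set (ends G e)" for b
      by (rule joined_trans[OF a(2) joined_edge[OF assms(3) True a(1) that]])
    then show ?thesis using u ends_in_verts[OF e] by auto
  next
    case False
    then have "length (ends G e) \<le> 1" using length_ends[OF e] e by (auto simp: two_ended_def)
    then show ?thesis using assms(4) by (cases "ends G e") auto
  qed
  then show ?thesis using assms u by (auto simp: edges_at_def)
qed

lemma graph_component_connected:
  assumes "S \<subseteq> edges G" "(X, T) \<in> graph_components G S"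
  shows "connected_subgraph G X T"
proof -
  obtain u where u: "X = {v \<in> verts G. joined G S u v}" "T = edges_at G S X" "u \<in> X"
    using assms(2) by (rule graph_componentE)
  have TX: "set (ends G e) \<subseteq> X" if "e \<in> T" for e
    using that u graph_component_closed[OF assms, of e] by (auto simp: edges_at_def)
  show ?thesis
  proof (rule connected_subgraph_joinedI[OF u(3)])
    show "X \<subseteq> verts G" "T \<subseteq> edges G" "verts_of G T \<subseteq> X"
      using u assms TX by (auto simp: edges_at_def verts_of_def)
  next
    fix v assume "v \<in> X"
    then have "joined G S u v" using u by auto
    then have "v \<in> {w \<in> X. joined G T u w}"
    proof (rule joined_closed)
      show "u \<in> {w \<in> X. joined G T u w}" using u joined_refl by auto
    next
      fix e assume e: "e \<in> S" "two_ended G e" "set (ends G e) \<inter> {w \<in> X. joined G T u w} \<noteq> {}"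
      then have eT: "e \<in> T" using graph_component_closed[OF assms, of e] by blast
      obtain a where a: "a \<in> set (ends G e)" "joined G T u a" using e by auto
      have "joined G T u b" if "b \<in> set (ends G e)" for b
        by (rule joined_trans[OF a(2) joined_edge[OF eT e(2) a(1) that]])
      then show "set (ends G e) \<subseteq> {w \<in> X. joined G T u w}" using TX[OF eT] by auto
    qed
    then show "joined G T u v" by simp
  qed
qed

lemma graph_component_of_vert:
  assumes "v \<in> verts G"
  obtains X T where "(X, T) \<in> graph_components G S" "v \<in> X"
proof -
  let ?X = "{w \<in> verts G. joined G S v w}"
  have "(?X, edges_at G S ?X) \<in> graph_components G S" "v \<in> ?X"
    using assms joined_refl by (auto simp: graph_components_def Let_def)
  then show ?thesis by (rule that)
qed

lemma graph_component_of_edge: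
  assumes "S \<subseteq> edges G" "e \<in> S" "\<not> loose_edge G e"
  obtains X T where "(X, T) \<in> graph_components G S" "e \<in> T"
proof -
  obtain v where v: "v \<in> set (ends G e)" 
    using assms by (cases "ends G e") (auto simp: loose_edge_def)
  moreover have "e \<in> edges G" using assms by blast
  ultimately have "v \<in> verts G" using ends_in_verts by blast
  then obtain X T where "(X, T) \<in> graph_components G S" "v \<in> X" by (rule graph_component_of_vert)
  then show ?thesis using that v graph_component_closed[OF assms(1) _ assms(2)] by blast
qed

text \<open>In the second case the vertex set is recovered as \<open>verts_of G U\<close>, so an
  edge component can be treated as a component without carrying its vertices along.\<close>

lemma edge_component_cases:
  assumes "S \<subseteq> edges G" "U \<in> edge_components G S"
  obtains e where "U = {e}" "e \<in> S" "loose_edge G e"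
  | "(verts_of G U, U) \<in> graph_components G S" "U \<noteq> {}" "connected_subgraph G (verts_of G U) U"
    "U \<subseteq> S" "\<And>e. e \<in> U \<Longrightarrow> \<not> loose_edge G e"
    "\<And>e. e \<in> S \<Longrightarrow> set (ends G e) \<inter> verts_of G U \<noteq> {} \<Longrightarrow> e \<in> U"
proof (cases "\<exists>e. U = {e} \<and> e \<in> S \<and> loose_edge G e")
  case True
  then show ?thesis using that by blast
next
  case False
  then obtain X where X: "(X, U) \<in> graph_components G S" "U \<noteq> {}"
    using assms(2) by (auto simp: edge_components_def)
  have U: "U = edges_at G S X" using X(1) by (rule graph_componentE)
  have conn: "connected_subgraph G X U" using graph_component_connected[OF assms(1) X(1)] .
  have "verts_of G U \<noteq> {}" using X(2) U by (auto simp: verts_of_def edges_at_def)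
  then have "verts_of G U = X" by (rule connected_subgraph_nonempty_verts[OF conn])
  then show ?thesis
  proof (intro that(2))
    show "\<And>e. e \<in> U \<Longrightarrow> \<not> loose_edge G e" "U \<subseteq> S"
      using U by (auto simp: edges_at_def loose_edge_def)
    show "\<And>e. e \<in> S \<Longrightarrow> set (ends G e) \<inter> verts_of G U \<noteq> {} \<Longrightarrow> e \<in> U"
      using graph_component_closed[OF assms(1) X(1)] \<open>verts_of G U = X\<close> by blast
  qed (use X conn in auto)
qed

lemma edge_component_subset: "S \<subseteq> edges G \<Longrightarrow> U \<in> edge_components G S \<Longrightarrow> U \<subseteq> S"
  by (erule (1) edge_component_cases) auto

lemma finite_edge_components: "S \<subseteq> edges G \<Longrightarrow> finite (edge_components G S)"
  by (rule finite_subset[of _ "Pow S"]) (use edge_component_subset finite_edge_set in auto)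

lemma edge_component_of_edge:
  assumes "S \<subseteq> edges G" "e \<in> S"
  obtains U where "U \<in> edge_components G S" "e \<in> U"
proof (cases "loose_edge G e")
  case True
  then show ?thesis using assms that[of "{e}"] by (auto simp: edge_components_def)
next
  case False
  then obtain X T where "(X, T) \<in> graph_components G S" "e \<in> T"
    using graph_component_of_edge[OF assms] by blast
  then show ?thesis using that[of T] by (auto simp: edge_components_def)
qed

lemma edge_components_verts_disjoint:
  assumes "S \<subseteq> edges G" "U \<in> edge_components G S" "U' \<in> edge_components G S" "U \<noteq> U'"
  shows "verts_of G U \<inter> verts_of G U' = {}"
proof (rule ccontr)
  assume ne: "verts_of G U \<inter> verts_of G U' \<noteq> {}"
  from assms(1,2) have "(verts_of G U, U) \<in> graph_components G S"
    by (rule edge_component_cases) (use ne in \<open>auto simp: verts_of_def loose_edge_def\<close>)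
  moreover from assms(1,3) have "(verts_of G U', U') \<in> graph_components G S"
    by (rule edge_component_cases) (use ne in \<open>auto simp: verts_of_def loose_edge_def\<close>)
  ultimately show False using graph_component_eq assms(4) ne by blast
qed

lemma edge_components_disjoint:
  assumes "S \<subseteq> edges G" "U \<in> edge_components G S" "U' \<in> edge_components G S" "U \<noteq> U'"
  shows "U \<inter> U' = {}"
proof (rule ccontr)
  assume "U \<inter> U' \<noteq> {}"
  then obtain e where e: "e \<in> U" "e \<in> U'" by auto
  have "ends G e = []"
    using edge_components_verts_disjoint[OF assms] e by (cases "ends G e") (force simp: verts_of_def)+
  then have l: "loose_edge G e"
    using e assms edge_component_subset[of S U] by (auto simp: loose_edge_def)
  from assms(1,2) have "U = {e}"
    by (rule edge_component_cases) (use e l in auto)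
  moreover from assms(1,3) have "U' = {e}"
    by (rule edge_component_cases) (use e l in auto)
  ultimately show False using assms by simp
qed

lemma connected_in_edge_component:
  assumes "S \<subseteq> edges G" "connected_subgraph G X C" "C \<subseteq> S" "C \<noteq> {}" 
    "\<And>e. e \<in> C \<Longrightarrow> \<not> loose_edge G e"
  obtains U where "U \<in> edge_components G S" "C \<subseteq> U"
proof -
  obtain e where e: "e \<in> C" using assms by auto
  then obtain Y T where T: "(Y, T) \<in> graph_components G S" "e \<in> T"
    using graph_component_of_edge[OF assms(1), of e] assms by blast
  have TY: "connected_subgraph G Y T" using graph_component_connected[OF assms(1) T(1)] .
  obtain a where a: "a \<in> set (ends G e)"
    using assms(3,5) e assms(1) by (cases "ends G e") (auto simp: loose_edge_def)
  have aX: "a \<in> X" "a \<in> Y" 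
    using a e assms(2) TY T(2) by (auto simp: connected_subgraph_def verts_of_def)
  have "f \<in> T" if f: "f \<in> C" for f
  proof -
    obtain b where b: "b \<in> set (ends G f)"
      using assms(3,5) f assms(1) by (cases "ends G f") (auto simp: loose_edge_def)
    then have "b \<in> X" using f assms(2) by (auto simp: connected_subgraph_def verts_of_def)
    then have "joined G C a b" using aX assms(2) by (auto simp: connected_subgraph_def)
    then have "b \<in> Y"
      using aX(2) by (rule joined_closed) (use graph_component_closed[OF assms(1) T(1)] assms(3) in blast)
    then show ?thesis using b f assms(3) graph_component_closed[OF assms(1) T(1), of f] by blast
  qed
  then show ?thesis using that[of T] T by (auto simp: edge_components_def)
qed

text \<open>Outside \<open>D\<close> there are at least as many edges as vertices, by connectedness;
  equality means that no edge is spent on closing a circle or on a second contact with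
  \<open>D\<close>. All shapes are recognized through this count.\<close>

lemma with_attached_trees_iff_card:
  assumes T: "connected_subgraph G X T" and no_loose: "\<And>e. e \<in> T \<Longrightarrow> \<not> loose_edge G e"
    and D: "D \<subseteq> T" "verts_of G D \<noteq> {}"
  shows "with_attached_trees G D T \<longleftrightarrow> card T + card (verts_of G D) = card X + card D"
proof -
  let ?V = "verts_of G D"
  note fin = finite_connected[OF T]
  have TE: "T \<subseteq> edges G" and TX: "verts_of G T \<subseteq> X" using T by (auto simp: connected_subgraph_def)
  have SE: "T - D \<subseteq> edges G" using TE by auto
  have VX: "?V \<subseteq> X" using TX verts_of_mono[OF D(1), of G] by auto
  have cX: "card (X - ?V) + card ?V = card X"
    using VX fin finite_subset[OF VX] card_mono[OF fin(1) VX] by (simp add: card_Diff_subset)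
  have cT: "card (T - D) + card D = card T"
    using D fin finite_subset[OF D(1)] card_mono[OF fin(2) D(1)] by (simp add: card_Diff_subset)
  have lower: "card (X - ?V) \<le> card (T - D)"
    using D VX by (intro card_diff_le_edges[OF T]) auto
  have iff: "card T + card ?V = card X + card D \<longleftrightarrow> card (T - D) = card (X - ?V)"
    using cX cT by linarith
  show ?thesis unfolding iff
  proof
    assume tr: "with_attached_trees G D T"
    \<comment> \<open>A tree with exactly one vertex on \<open>D\<close> has as many edges as
      vertices off \<open>D\<close>.\<close>
    have comp: "card U = card (verts_of G U - ?V)" if U: "U \<in> edge_components G (T - D)" for U
    proof -
      have t: "tree G (verts_of G U) U" "card (verts_of G U \<inter> ?V) = 1"
        using tr U by (auto simp: with_attached_trees_def)
      have "finite (verts_of G U)"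
        using t(1) finite_connected by (auto simp: tree_def)
      then have "card (verts_of G U) = card (verts_of G U \<inter> ?V) + card (verts_of G U - ?V)"
        by (metis card_Int_Diff card.infinite finite_Int)
      then show ?thesis using tree_card[OF t(1)] t(2) by simp
    qed
    have finU: "finite U" "finite (verts_of G U)" "verts_of G U \<subseteq> X"
      if "U \<in> edge_components G (T - D)" for U
    proof -
      have "U \<subseteq> T" using edge_component_subset[OF SE that] by auto
      then show "finite U" "verts_of G U \<subseteq> X"
        using finite_subset[OF _ fin(2)] TX verts_of_mono[of U T G] by auto
      then show "finite (verts_of G U)" using finite_subset[OF _ fin(1)] by auto
    qed
    \<comment> \<open>Only an upper bound is derived from here on; \<open>lower\<close> is the
      reverse inequality.\<close>
    have "T - D = (\<Union>U\<in>edge_components G (T - D). U)"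
      using edge_component_of_edge[OF SE] edge_component_subset[OF SE] by blast
    then have "card (T - D) \<le> (\<Sum>U\<in>edge_components G (T - D). card U)"
      using card_UN_le[OF finite_edge_components[OF SE], of "\<lambda>U. U"] by simp
    also have "\<dots> = (\<Sum>U\<in>edge_components G (T - D). card (verts_of G U - ?V))"
      using comp by (intro sum.cong) auto
    also have "\<dots> = card (\<Union>U\<in>edge_components G (T - D). verts_of G U - ?V)"
    proof (rule card_UN_disjoint[symmetric])
      show "finite (edge_components G (T - D))" by (rule finite_edge_components[OF SE])
      show "\<forall>U\<in>edge_components G (T - D). finite (verts_of G U - ?V)" using finU by auto
      show "\<forall>U\<in>edge_components G (T - D). \<forall>U'\<in>edge_components G (T - D). U \<noteq> U' \<longrightarrow>
          (verts_of G U - ?V) \<inter> (verts_of G U' - ?V) = {}"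
        using edge_components_verts_disjoint[OF SE] by blast
    qed
    also have "\<dots> \<le> card (X - ?V)" using finU(3) fin by (intro card_mono) auto
    finally show "card (T - D) = card (X - ?V)" using lower by simp
  next
    assume eq: "card (T - D) = card (X - ?V)"
    have "tree G (verts_of G U) U \<and> card (verts_of G U \<inter> ?V) = 1"
      if U: "U \<in> edge_components G (T - D)" for U
    proof -
      let ?W = "verts_of G U"
      have conn: "connected_subgraph G ?W U"
        and cl: "\<And>e. e \<in> T - D \<Longrightarrow> set (ends G e) \<inter> ?W \<noteq> {} \<Longrightarrow> e \<in> U"
        using no_loose by (rule_tac edge_component_cases[OF SE U]; blast)+
      have US: "U \<subseteq> T - D" by (rule edge_component_subset[OF SE U])
      have WX: "?W \<subseteq> X" using US TX verts_of_mono[of U T G] by auto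
      have finW: "finite ?W" "finite U" using finite_connected[OF conn] by auto
      \<comment> \<open>A component missing \<open>D\<close> would be closed under all edges of
        \<open>T\<close>, against connectedness.\<close>
      have "?W \<inter> ?V \<noteq> {}"
      proof
        assume d: "?W \<inter> ?V = {}"
        obtain u where u: "u \<in> ?W" using conn by (auto simp: connected_subgraph_def)
        obtain v where v: "v \<in> ?V" using D(2) by auto
        have "u \<in> X" "v \<in> X" using u v WX VX by auto
        then have "joined G T u v" using T by (simp add: connected_subgraph_def)
        then have "v \<in> ?W" using u
        proof (rule joined_closed)
          fix e assume e: "e \<in> T" "set (ends G e) \<inter> ?W \<noteq> {}"
          then have "e \<notin> D" using d by (auto simp: verts_of_def)
          then show "set (ends G e) \<subseteq> ?W" using cl[of e] e by (auto simp: verts_of_def)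
        qed
        then show False using v d by auto
      qed
      then have inter: "card (?W \<inter> ?V) \<ge> 1" using finW by (simp add: Suc_le_eq card_gt_0_iff)
      have split: "card ?W = card (?W \<inter> ?V) + card (?W - ?V)"
        using finW by (metis card_Int_Diff card.infinite finite_Int)
      \<comment> \<open>Adding \<open>U\<close> to the core bounds the edges of the remaining
        components from below, and hence, by \<open>eq\<close>, those of \<open>U\<close> from
        above.\<close>
      have 1: "card (X - (?V \<union> ?W)) \<le> card (T - (D \<union> U))"
        using D US VX WX by (intro card_diff_le_edges[OF T]) (auto simp: verts_of_Un)
      have "T - (D \<union> U) = (T - D) - U" by auto
      then have 2: "card (T - (D \<union> U)) + card U = card (T - D)"
        using US finW fin card_mono[of "T - D" U] by (simp add: card_Diff_subset)
      have "X - (?V \<union> ?W) = (X - ?V) - (?W - ?V)" by auto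
      then have 3: "card (X - (?V \<union> ?W)) + card (?W - ?V) = card (X - ?V)"
        using WX fin card_mono[of "X - ?V" "?W - ?V"] finW
        by (simp add: card_Diff_subset Diff_mono)
      have "card U \<le> card (?W - ?V)" using 1 2 3 eq by linarith
      then have "card U < card ?W" using split inter by linarith
      then have "tree G ?W U" using conn US no_loose by (intro treeI) auto
      moreover have "card (?W \<inter> ?V) = 1"
        using \<open>card U \<le> card (?W - ?V)\<close> split inter tree_card[OF calculation] by linarith
      ultimately show ?thesis by simp
    qed
    then show "with_attached_trees G D T" using D by (auto simp: with_attached_trees_def)
  qed
qed

section \<open>Handcuffs and theta graphs\<close>

lemma connected_subgraph_Un:
  assumes "connected_subgraph G X A" "connected_subgraph G Y B" "X \<inter> Y \<noteq> {}"
  shows "connected_subgraph G (X \<union> Y) (A \<union> B)"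
proof -
  obtain w where w: "w \<in> X" "w \<in> Y" using assms(3) by auto
  show ?thesis
  proof (rule connected_subgraph_joinedI[of w])
    fix v assume "v \<in> X \<union> Y"
    then have "joined G A w v \<or> joined G B w v"
      using assms(1,2) w by (auto simp: connected_subgraph_def)
    then show "joined G (A \<union> B) w v" by (auto elim: joined_mono)
  qed (use assms(1,2) w in \<open>auto simp: connected_subgraph_def verts_of_Un\<close>)
qed

lemma walk_connected:
  "walk G u W v \<Longrightarrow> connected_subgraph G (set (walk_verts G u W)) (walk_edges W)"
proof (induction W arbitrary: u)
  case Nil
  then show ?case using joined_refl by (auto simp: connected_subgraph_def)
next
  case (Cons s W)
  obtain e i where s: "s = (e, i)" by fastforce
  let ?w = "step_target G s"
  have e: "two_ended G e" "set (ends G e) = {u, ?w}" and W: "walk G ?w W v"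
    using Cons.prems s step_ends[of e i] by auto
  have "connected_subgraph G {u, ?w} {e}"
    unfolding connected_subgraph_def
    using e ends_in_verts[of e] joined_edge[OF _ e(1), of "{e}"]
    by (auto simp: two_ended_def verts_of_def)
  then have "connected_subgraph G ({u, ?w} \<union> set (walk_verts G ?w W)) ({e} \<union> walk_edges W)"
    by (rule connected_subgraph_Un[OF _ Cons.IH[OF W]])
      (use walk_end_in_walk_verts[OF W] in auto)
  moreover have "{u, ?w} \<union> set (walk_verts G ?w W) = set (walk_verts G u (s # W))"
    using walk_end_in_walk_verts[OF W] by auto
  ultimately show ?case using s by simp
qed

text \<open>A path contains no loops, so a common edge would put two vertices into the one-point
  intersection.\<close>

lemma path_off_figure:
  assumes P: "walk_path G u P v" and V: "set (walk_verts G u P) \<inter> verts_of G F = {w}"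
  shows "walk_edges P \<inter> F = {}"
proof (rule ccontr)
  assume "walk_edges P \<inter> F \<noteq> {}"
  then obtain e where e: "e \<in> walk_edges P" "e \<in> F" by auto
  have W: "walk G u P v" using P by (simp add: walk_path_def)
  obtain a b where ab: "ends G e = [a, b]"
    by (rule two_ended_ends[OF walk_edges_two_ended[OF W e(1)]])
  have "a \<noteq> b" using walk_path_card[OF P] e(1) ab by auto
  moreover have "set (ends G e) \<subseteq> set (walk_verts G u P) \<inter> verts_of G F"
    using e set_walk_verts[OF W] by (auto simp: verts_of_def)
  ultimately show False using ab V by auto
qed

text \<open>A common edge would have a single vertex, hence be a loop or a half edge; this is a
  figure by itself and so equals both figures.\<close>

lemma figures_disjoint:
  assumes F: "figure G F" "figure G F'" "F \<noteq> F'" and V: "card (verts_of G F \<inter> verts_of G F') \<le> 1"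
  shows "F \<inter> F' = {}"
proof (rule ccontr)
  assume "F \<inter> F' \<noteq> {}"
  then obtain e where e: "e \<in> F" "e \<in> F'" by auto
  have "set (ends G e) \<subseteq> verts_of G F \<inter> verts_of G F'" using e by (auto simp: verts_of_def)
  moreover have "finite (verts_of G F \<inter> verts_of G F')"
    using finite_verts_of[OF figure_edges[OF F(1)]] by simp
  ultimately have c: "card (set (ends G e)) \<le> 1" using V card_mono le_trans by blast
  have "figure G {e}"
  proof (cases "half_edge G e")
    case True
    then show ?thesis by (simp add: figure_def)
  next
    case False
    then have te: "two_ended G e" using F(1) e(1) circle_two_ended by (auto simp: figure_def)
    then have "\<exists>C. C \<subseteq> {e} \<and> circle G C"
      using c by (intro contains_circle) (auto simp: verts_of_def)
    then have "circle G {e}" using circle_nonempty by (metis subset_singletonD)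
    then show ?thesis by (simp add: figure_def)
  qed
  then have "{e} = F" "{e} = F'" using figure_subset_eq F e by (metis empty_subsetI insert_subset)+
  then show False using F(3) by simp
qed

lemma handcuff_figures_disjoint: "handcuff G C1 u P v C2 \<Longrightarrow> C1 \<inter> C2 = {}"
  using figures_disjoint by (simp add: handcuff_def)

text \<open>In the figures edges and vertices balance, the path has one edge less than vertices, and
  two vertex counts are redundant: -1 + 2 = 1.\<close>

lemma
  assumes "handcuff G C1 u P v C2" and D: "D = C1 \<union> walk_edges P \<union> C2"
  shows handcuff_connected: "connected_subgraph G (verts_of G D) D"
    and handcuff_card: "card D = card (verts_of G D) + 1"
proof -
  let ?VP = "set (walk_verts G u P)"
  have F: "figure G C1" "figure G C2" "C1 \<noteq> C2" "card (verts_of G C1 \<inter> verts_of G C2) \<le> 1"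
    and P: "walk_path G u P v"
    and VP: "?VP \<inter> verts_of G C1 = {u}" "?VP \<inter> verts_of G C2 = {v}"
    and PN: "verts_of G C1 \<inter> verts_of G C2 \<noteq> {} \<Longrightarrow> P = []"
    using assms(1) by (auto simp: handcuff_def)
  have W: "walk G u P v" using P by (simp add: walk_path_def)
  have VD: "verts_of G D = verts_of G C1 \<union> ?VP \<union> verts_of G C2"
    unfolding D set_walk_verts[OF W] using VP(1) by (auto simp: verts_of_Un)
  show "connected_subgraph G (verts_of G D) D"
    unfolding VD unfolding D using VP
    by (intro connected_subgraph_Un walk_connected[OF W] figure_connected F) auto
  have fin: "finite C1" "finite C2" "finite (verts_of G C1)" "finite (verts_of G C2)"
    using finite_connected[OF figure_connected[OF F(1)]] finite_connected[OF figure_connected[OF F(2)]]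
    by simp_all
  have "card D = card C1 + card (walk_edges P) + card C2"
  proof -
    have "card (C1 \<union> walk_edges P) = card C1 + card (walk_edges P)"
      using path_off_figure[OF P VP(1)] fin by (intro card_Un_disjoint) auto
    moreover have "card (C1 \<union> walk_edges P \<union> C2) = card (C1 \<union> walk_edges P) + card C2"
      using path_off_figure[OF P VP(2)] handcuff_figures_disjoint[OF assms(1)] fin
      by (intro card_Un_disjoint) auto
    ultimately show ?thesis using D by simp
  qed
  \<comment> \<open>The 2 corrects for \<open>u\<close> and \<open>v\<close>, each counted in the
    path and in its figure; if the figures touch, \<open>u = v\<close> is a single vertex counted
    three times.\<close>
  moreover have "card (verts_of G D) + 2 = card (verts_of G C1) + card ?VP + card (verts_of G C2)"
  proof -
    have "card (verts_of G C1) + card ?VP = card (verts_of G C1 \<union> ?VP) + card (verts_of G C1 \<inter> ?VP)"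
      using fin by (intro card_Un_Int) auto
    moreover have "verts_of G C1 \<inter> ?VP = {u}" using VP by auto
    moreover have "card (verts_of G C1 \<union> ?VP) + card (verts_of G C2) =
        card (verts_of G C1 \<union> ?VP \<union> verts_of G C2) + card ((verts_of G C1 \<union> ?VP) \<inter> verts_of G C2)"
      using fin by (intro card_Un_Int) auto
    moreover have "(verts_of G C1 \<union> ?VP) \<inter> verts_of G C2 = {v}"
    proof (cases "verts_of G C1 \<inter> verts_of G C2 = {}")
      case True
      then show ?thesis using VP by auto
    next
      case False
      then have "P = []" by (rule PN)
      then have "u = v" "u \<in> verts_of G C1 \<inter> verts_of G C2" using VP by auto
      then have "verts_of G C1 \<inter> verts_of G C2 = {u}"
        using F(4) fin card_le_Suc0_iff_eq[of "verts_of G C1 \<inter> verts_of G C2"] by auto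
      then show ?thesis using VP \<open>u = v\<close> by auto
    qed
    ultimately show ?thesis using VD by simp
  qed
  ultimately show "card D = card (verts_of G D) + 1"
    using walk_path_card[OF P] figure_card[OF F(1)] figure_card[OF F(2)] by linarith
qed

text \<open>Each of the three paths has one edge less than vertices, and \<open>x\<close> and
  \<open>y\<close> are each counted twice too often: -3 + 4 = 1.\<close>

lemma theta_card:
  assumes "theta_graph G D"
  shows "card D = card (verts_of G D) + 1" "verts_of G D \<noteq> {}"
proof -
  obtain x y P Q R where xy: "x \<noteq> y"
    and path: "walk_path G x P y" "walk_path G x Q y" "walk_path G x R y"
    and dis: "walk_edges P \<inter> walk_edges Q = {}" "walk_edges P \<inter> walk_edges R = {}"
      "walk_edges Q \<inter> walk_edges R = {}"
    and V: "set (walk_verts G x P) \<inter> set (walk_verts G x Q) = {x, y}"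
      "set (walk_verts G x P) \<inter> set (walk_verts G x R) = {x, y}"
      "set (walk_verts G x Q) \<inter> set (walk_verts G x R) = {x, y}"
    and D: "D = walk_edges P \<union> walk_edges Q \<union> walk_edges R"
    using assms unfolding theta_graph_def by blast
  let ?P = "set (walk_verts G x P)" and ?Q = "set (walk_verts G x Q)" and ?R = "set (walk_verts G x R)"
  have VD: "verts_of G D = ?P \<union> ?Q \<union> ?R"
    using path xy by (simp add: D verts_of_Un walk_path_verts_of)
  have "card (walk_edges P \<union> walk_edges Q) = card (walk_edges P) + card (walk_edges Q)"
    using dis by (intro card_Un_disjoint) auto
  moreover have "card D = card (walk_edges P \<union> walk_edges Q) + card (walk_edges R)"
    unfolding D using dis by (intro card_Un_disjoint) auto
  moreover have "card ?P + card ?Q = card (?P \<union> ?Q) + card (?P \<inter> ?Q)" by (rule card_Un_Int) auto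
  moreover have "card (?P \<union> ?Q) + card ?R = card (?P \<union> ?Q \<union> ?R) + card ((?P \<union> ?Q) \<inter> ?R)"
    by (rule card_Un_Int) auto
  moreover have "(?P \<union> ?Q) \<inter> ?R = {x, y}" using V by blast
  ultimately show "card D = card (verts_of G D) + 1"
    using walk_path_card[OF path(1)] walk_path_card[OF path(2)] walk_path_card[OF path(3)] V xy VD
    by simp
  show "verts_of G D \<noteq> {}" using VD V by auto
qed

lemma handcuff_exists:
  assumes T: "connected_subgraph G X T" "card T \<le> card X + 1"
    and F: "figure G F" "F \<subseteq> T" "figure G F'" "F' \<subseteq> T" "F \<inter> F' = {}"
  shows "\<exists>u P v. handcuff G F u P v F' \<and> walk_edges P \<subseteq> T"
proof -
  let ?V = "verts_of G F" and ?V' = "verts_of G F'"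
  note fin = finite_connected[OF T(1)]
  have VX: "?V \<subseteq> X" "?V' \<subseteq> X"
    using T(1) verts_of_mono[OF F(2), of G] verts_of_mono[OF F(4), of G]
    by (auto simp: connected_subgraph_def)
  have finF: "finite F" "finite F'" "finite ?V" "finite ?V'"
    using finite_connected[OF figure_connected[OF F(1)]] finite_connected[OF figure_connected[OF F(3)]]
    by simp_all
  have ne: "F \<noteq> F'" using F figure_nonempty by auto
  have inter: "card (?V \<inter> ?V') \<le> 1"
  proof -
    \<comment> \<open>Since figures have as many edges as vertices, counting outside both of them
      bounds the number of common vertices by \<open>card T - card X\<close>.\<close>
    have "card (X - (?V \<union> ?V')) \<le> card (T - (F \<union> F'))"
      using F VX figure_nonempty[OF F(1)]
      by (intro card_diff_le_edges[OF T(1)]) (auto simp: verts_of_Un)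
    moreover have "card (X - (?V \<union> ?V')) + card (?V \<union> ?V') = card X"
      using VX fin finF card_mono[of X "?V \<union> ?V'"] by (simp add: card_Diff_subset)
    moreover have "card (T - (F \<union> F')) + card (F \<union> F') = card T"
      using F fin finF card_mono[of T "F \<union> F'"] by (simp add: card_Diff_subset)
    moreover have "card (F \<union> F') = card F + card F'" using F finF by (intro card_Un_disjoint)
    moreover have "card ?V + card ?V' = card (?V \<union> ?V') + card (?V \<inter> ?V')"
      using finF by (intro card_Un_Int)
    ultimately show ?thesis using T(2) figure_card[OF F(1)] figure_card[OF F(3)] by linarith
  qed
  show ?thesis
  proof (cases "?V \<inter> ?V' = {}")
    case True
    obtain x y where xy: "x \<in> ?V'" "y \<in> ?V"
      using figure_nonempty[OF F(1)] figure_nonempty[OF F(3)] by blast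
    then have "x \<in> X" "y \<in> X" using VX by auto
    then have "joined G T x y" using T(1) by (simp add: connected_subgraph_def)
    then obtain P u where P: "walk_path G x P u" "walk_edges P \<subseteq> T" "set (walk_verts G x P) \<inter> ?V = {u}"
      using path_to_set[of T x y ?V] xy by blast
    have WP: "walk G x P u" using P(1) by (simp add: walk_path_def)
    \<comment> \<open>\<open>P\<close> is followed back from \<open>u\<close> to the first vertex of
      \<open>?V'\<close>; staying on \<open>P\<close>, the new path meets \<open>?V\<close> only in
      \<open>u\<close>.\<close>
    have "joined G (walk_edges P) u x"
      by (rule joined_sym) (use WP in \<open>auto simp: joined_def\<close>)
    then obtain Q v where Q: "walk_path G u Q v" "walk_edges Q \<subseteq> walk_edges P"
        "set (walk_verts G u Q) \<inter> ?V' = {v}"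
      using path_to_set[of "walk_edges P" u x ?V'] xy by blast
    have WQ: "walk G u Q v" using Q(1) by (simp add: walk_path_def)
    have "set (walk_verts G u Q) \<subseteq> set (walk_verts G x P)"
      using set_walk_verts[OF WQ] set_walk_verts[OF WP] verts_of_mono[OF Q(2), of G] P(3) by auto
    then have "set (walk_verts G u Q) \<inter> ?V = {u}"
      using P(3) walk_end_in_walk_verts[OF WQ] by auto
    then have "handcuff G F u Q v F'" using F ne inter Q True by (auto simp: handcuff_def)
    then show ?thesis using Q(2) P(2) by blast
  next
    case False
    then obtain w where w: "w \<in> ?V" "w \<in> ?V'" by auto
    have "w \<in> verts G" using w verts_of_in_verts[OF figure_edges[OF F(1)]] by auto
    then have "handcuff G F w [] w F'"
      using F ne inter w by (auto simp: handcuff_def walk_path_def)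
    then show ?thesis by fastforce
  qed
qed

text \<open>The component of \<open>A - {e}\<close> containing both ends lacks at most one edge
  compared with its vertices, and \<open>e\<close> makes up for it, so
  \<open>contains_circle\<close> applies.\<close>

lemma circle_through_edge:
  assumes A: "\<And>e. e \<in> A \<Longrightarrow> two_ended G e" and e: "e \<in> A" "ends G e = [x, y]"
    and j: "joined G (A - {e}) x y"
  shows "\<exists>C. C \<subseteq> A \<and> circle G C"
proof -
  have AE: "A - {e} \<subseteq> edges G" using A by (auto simp: two_ended_def)
  obtain Y U where U: "(Y, U) \<in> graph_components G (A - {e})" "x \<in> Y"
    using graph_component_of_vert joined_in_verts[OF j] by blast
  have conn: "connected_subgraph G Y U" by (rule graph_component_connected[OF AE U(1)])
  have "y \<in> Y"
    using j U(2) by (rule joined_closed) (use graph_component_closed[OF AE U(1)] in blast)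
  have US: "U \<subseteq> A - {e}" using U(1) by (rule graph_componentE) (auto simp: edges_at_def)
  have "verts_of G (insert e U) \<subseteq> Y"
    using conn U(2) \<open>y \<in> Y\<close> e by (auto simp: verts_of_def connected_subgraph_def)
  then have "card (verts_of G (insert e U)) \<le> card Y"
    using finite_connected[OF conn] by (intro card_mono)
  also have "\<dots> \<le> card U + 1" by (rule card_le_edges_Suc[OF conn])
  also have "\<dots> = card (insert e U)" using US finite_connected[OF conn] by (subst card_insert_disjoint) auto
  finally have "\<exists>C. C \<subseteq> insert e U \<and> circle G C" using US A e by (intro contains_circle) auto
  then show ?thesis using US e by blast
qed

text \<open>
  The first vertices of \<open>N\<close> reached in \<open>F\<close> from the two ends of an edge outside \<open>N\<close> are different,
  for otherwise \<open>F - N\<close> would contain a circle properly contained in \<open>F\<close>.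
\<close>

lemma circle_chord:
  assumes C: "circle G N" "circle G F" "N \<noteq> F" "N \<inter> F \<noteq> {}"
  obtains x y where "x \<in> verts_of G N" "y \<in> verts_of G N" "x \<noteq> y" "joined G (F - N) x y"
proof -
  have fig: "figure G N" "figure G F" using C by (auto simp: figure_def)
  obtain e where e: "e \<in> F" "e \<notin> N" using figure_not_subset[OF fig(2,1)] C(3) by blast
  obtain a b where ab: "ends G e = [a, b]" by (rule two_ended_ends[OF circle_two_ended[OF C(2) e(1)]])
  have conn: "connected_subgraph G (verts_of G F) (F - {e})"
    by (rule connected_delete_figure_edge[OF figure_connected[OF fig(2)] fig(2) subset_refl e(1)])
  obtain g where g: "g \<in> N" "g \<in> F" using C(4) by auto
  obtain z z' where z: "ends G g = [z, z']" by (rule two_ended_ends[OF circle_two_ended[OF C(1) g(1)]])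
  have zV: "z \<in> verts_of G N" "z \<in> verts_of G F" using z g by (force simp: verts_of_def)+
  \<comment> \<open>The common edge \<open>g\<close> supplies a vertex \<open>z\<close> on both
    circles; a path in \<open>F - {e}\<close> towards \<open>z\<close>, stopped at its first vertex
    on \<open>N\<close>, uses no edge of \<open>N\<close>.\<close>
  have reach: "\<exists>w\<in>verts_of G N. joined G (F - N - {e}) c w" if "c \<in> verts_of G F" for c
  proof -
    have "joined G (F - {e}) c z" using conn that zV by (auto simp: connected_subgraph_def)
    then obtain P w where P: "walk_path G c P w" "walk_edges P \<subseteq> F - {e}"
        "set (walk_verts G c P) \<inter> verts_of G N = {w}"
      using path_to_set[of "F - {e}" c z "verts_of G N"] zV by blast
    have "walk_edges P \<subseteq> F - N - {e}" using P(2) path_off_figure[OF P(1,3)] by auto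
    then have "joined G (F - N - {e}) c w" using P(1) by (auto simp: joined_def walk_path_def)
    then show ?thesis using P(3) by auto
  qed
  have "a \<in> verts_of G F" "b \<in> verts_of G F" using ab e by (force simp: verts_of_def)+
  then obtain x y where xy: "x \<in> verts_of G N" "y \<in> verts_of G N"
      "joined G (F - N - {e}) a x" "joined G (F - N - {e}) b y"
    using reach by meson
  have "x \<noteq> y"
  proof
    assume "x = y"
    then have "joined G (F - N - {e}) a b"
      using joined_trans[OF xy(3)] joined_sym[OF xy(4)] by simp
    then obtain K where "K \<subseteq> F - N" "circle G K"
      using circle_through_edge[of "F - N" e a b] e ab circle_two_ended[OF C(2)] by auto
    then show False using circle_subset_eq[of K F] C by blast
  qed
  moreover have "joined G (F - N) x y"
  proof -
    have "joined G (F - N) a x" "joined G (F - N) b y"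
      by (rule joined_mono[OF xy(3)], blast, rule joined_mono[OF xy(4)], blast)
    moreover have "joined G (F - N) a b"
      using e ab circle_two_ended[OF C(2)] by (intro joined_edge[of e]) auto
    ultimately show ?thesis using joined_trans[OF joined_sym, of "F - N" a x y] joined_trans[of "F - N" a b y]
      by blast
  qed
  ultimately show ?thesis using that xy by blast
qed

lemma path_between:
  assumes "joined G S x y"
  obtains P where "walk_path G x P y" "walk_edges P \<subseteq> S"
proof -
  obtain P v where P: "walk_path G x P v" "walk_edges P \<subseteq> S" "set (walk_verts G x P) \<inter> {y} = {v}"
    using path_to_set[OF assms, of "{y}"] by blast
  then have "v = y" by auto
  then show ?thesis using that P by blast
qed

text \<open>Removing one path leaves its ends joined, which gives a second path. Their union covers
  no more vertices than it has edges, so it contains a circle and is all of \<open>N\<close>; the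
  exact count then leaves only two common vertices.\<close>

lemma circle_split:
  assumes C: "circle G N" and xy: "x \<in> verts_of G N" "y \<in> verts_of G N" "x \<noteq> y"
  obtains P R where "walk_path G x P y" "walk_path G x R y" "walk_edges P \<inter> walk_edges R = {}"
    "set (walk_verts G x P) \<inter> set (walk_verts G x R) = {x, y}"
    "N = walk_edges P \<union> walk_edges R"
proof -
  have "joined G N x y" using C xy by (simp add: circle_def connected_subgraph_def)
  then obtain P where P: "walk_path G x P y" "walk_edges P \<subseteq> N"
    by (rule path_between)
  have WP: "walk G x P y" using P(1) by (simp add: walk_path_def)
  have "joined G (N - walk_edges P) x y"
    using circle_two_ended[OF C] circle_even_degree[OF C] WP P(2) walk_path_card[OF P(1)]
    by (intro joined_off_trail) auto
  then obtain R where R: "walk_path G x R y" "walk_edges R \<subseteq> N - walk_edges P"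
    by (rule path_between)
  have WR: "walk G x R y" using R(1) by (simp add: walk_path_def)
  let ?P = "set (walk_verts G x P)" and ?R = "set (walk_verts G x R)" and ?U = "walk_edges P \<union> walk_edges R"
  have VU: "verts_of G ?U = ?P \<union> ?R"
    using walk_path_verts_of[OF P(1)] walk_path_verts_of[OF R(1)] xy by (simp add: verts_of_Un)
  have in2: "{x, y} \<subseteq> ?P \<inter> ?R"
    using walk_end_in_walk_verts[OF WP] walk_end_in_walk_verts[OF WR] by auto
  then have two: "2 \<le> card (?P \<inter> ?R)" using card_mono[of "?P \<inter> ?R" "{x, y}"] xy by simp
  have cU: "card ?U = card (walk_edges P) + card (walk_edges R)"
    using R(2) by (intro card_Un_disjoint) auto
  have cV: "card ?P + card ?R = card (?P \<union> ?R) + card (?P \<inter> ?R)" by (rule card_Un_Int) auto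
  have cPR: "card (walk_edges P) + 1 = card ?P" "card (walk_edges R) + 1 = card ?R"
    using walk_path_card[OF P(1)] walk_path_card[OF R(1)] by auto
  have "P \<noteq> []" using WP xy by auto
  then have "?U \<noteq> {}" by (cases P) auto
  moreover have "card (verts_of G ?U) \<le> card ?U" using VU cU cV cPR two by simp
  moreover have "two_ended G e" if "e \<in> ?U" for e
    using that P(2) R(2) circle_two_ended[OF C, of e] by blast
  ultimately obtain K where K: "K \<subseteq> ?U" "circle G K" using contains_circle[of ?U] by blast
  have "?U \<subseteq> N" using P R by auto
  then have "K = N" using circle_subset_eq[OF K(2) C] K(1) by auto
  then have N: "N = ?U" using K(1) \<open>?U \<subseteq> N\<close> by auto
  then have "card (?P \<inter> ?R) = 2" using circle_card[OF C] VU cU cV cPR by simp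
  then have "{x, y} = ?P \<inter> ?R" using in2 xy by (intro card_subset_eq) auto
  then show ?thesis using that P R N by blast
qed

text \<open>A path through \<open>F - N\<close> with both ends on \<open>N\<close> is the third
  path, beside the two arcs of \<open>N\<close>.\<close>

lemma theta_exists:
  assumes C: "circle G N" "circle G F" "N \<noteq> F" "N \<inter> F \<noteq> {}"
  shows "\<exists>D. D \<subseteq> N \<union> F \<and> N \<subseteq> D \<and> theta_graph G D"
proof -
  obtain x z where x: "x \<in> verts_of G N" "z \<in> verts_of G N" "x \<noteq> z" "joined G (F - N) x z"
    by (rule circle_chord[OF C])
  \<comment> \<open>Taking \<open>x\<close> out of the target set keeps the path from stopping at
    its start, so it ends at the first other vertex of \<open>N\<close>.\<close>
  then obtain Q y where Q: "walk_path G x Q y" "walk_edges Q \<subseteq> F - N"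
      "set (walk_verts G x Q) \<inter> (verts_of G N - {x}) = {y}"
    using path_to_set[of "F - N" x z "verts_of G N - {x}"] by blast
  have WQ: "walk G x Q y" using Q(1) by (simp add: walk_path_def)
  have y: "y \<in> verts_of G N" "x \<noteq> y" using Q(3) by auto
  have VQ: "set (walk_verts G x Q) \<inter> verts_of G N = {x, y}"
    using Q(3) x(1) walk_end_in_walk_verts[OF WQ] by auto
  obtain P R where PR: "walk_path G x P y" "walk_path G x R y" "walk_edges P \<inter> walk_edges R = {}"
      "set (walk_verts G x P) \<inter> set (walk_verts G x R) = {x, y}"
      "N = walk_edges P \<union> walk_edges R"
    by (rule circle_split[OF C(1) x(1) y])
  have V: "verts_of G N = set (walk_verts G x P) \<union> set (walk_verts G x R)"
    using walk_path_verts_of PR y(2) by (simp add: verts_of_Un)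
  have "set (walk_verts G x P) \<inter> set (walk_verts G x Q) = {x, y}"
    "set (walk_verts G x Q) \<inter> set (walk_verts G x R) = {x, y}"
    using V VQ PR(4) by blast+
  moreover have "walk_edges P \<inter> walk_edges Q = {}" "walk_edges Q \<inter> walk_edges R = {}"
    using Q(2) PR(5) by auto
  ultimately have "theta_graph G (walk_edges P \<union> walk_edges Q \<union> walk_edges R)"
    unfolding theta_graph_def using PR(1-4) Q(1) y(2) by blast
  then show ?thesis using PR(5) Q(2) by (intro exI[of _ "walk_edges P \<union> walk_edges Q \<union> walk_edges R"]) auto
qed

section \<open>Sign circuits in graphs of small cyclomatic number\<close>

lemma prod_esign: "A \<subseteq> edges G \<Longrightarrow> (\<Prod>e\<in>A. esign G e) \<in> {1, -1}"
proof (induction A rule: infinite_finite_induct)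
  case (insert e A)
  then have "esign G e \<in> {1, -1}" using esign by auto
  then show ?case using insert by auto
qed auto

lemma circle_sign_cases: "circle G C \<Longrightarrow> positive_circle G C \<or> negative_circle G C"
  using prod_esign[OF circle_edges, of C] by (auto simp: positive_circle_def negative_circle_def)

lemma figure_sign_cases: "figure G F \<Longrightarrow> positive_circle G F \<or> negative_figure G F"
  using circle_sign_cases by (auto simp: figure_def negative_figure_def)

lemma not_positive_negative: "positive_circle G F \<Longrightarrow> \<not> negative_figure G F"
  using circle_two_ended not_half_two_ended
  by (force simp: positive_circle_def negative_figure_def negative_circle_def)

lemma positive_circle_figure: "positive_circle G F \<Longrightarrow> figure G F"
  by (simp add: positive_circle_def figure_def)

text \<open>The sign of \<open>C1 \<inter> C2\<close> is a common factor 1 or -1 of both products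
  and cancels.\<close>

lemma sign_sym_diff:
  assumes "finite C1" "finite C2" "C1 \<subseteq> edges G" "C2 \<subseteq> edges G"
    and "(\<Prod>e\<in>C1. esign G e) = (\<Prod>e\<in>C2. esign G e)"
  shows "(\<Prod>e\<in>(C1 - C2) \<union> (C2 - C1). esign G e) = 1"
proof -
  let ?s = "\<lambda>A. \<Prod>e\<in>A. esign G e"
  have "?s (C1 - C2 \<union> (C2 - C1)) = ?s (C1 - C2) * ?s (C2 - C1)"
    using assms by (intro prod.union_disjoint) auto
  moreover have "?s C1 = ?s (C1 - C2) * ?s (C1 \<inter> C2)"
    using assms(1) prod.Int_Diff[of C1 "esign G" C2] by (simp add: mult.commute)
  moreover have "?s C2 = ?s (C2 - C1) * ?s (C1 \<inter> C2)"
    using assms(2) prod.Int_Diff[of C2 "esign G" C1] by (simp add: mult.commute Int_commute)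
  moreover have "?s (C1 - C2) \<in> {1, -1}" "?s (C2 - C1) \<in> {1, -1}" "?s (C1 \<inter> C2) \<in> {1, -1}"
    using assms(3,4) by (intro prod_esign; auto)+
  ultimately show ?thesis using assms(5) by auto
qed

lemma sign_circuit_cases:
  assumes "sign_circuit G C" "\<And>e. e \<in> C \<Longrightarrow> \<not> loose_edge G e"
  obtains "positive_circle G C"
  | C1 u P v C2 where "handcuff G C1 u P v C2" "negative_figure G C1" "negative_figure G C2"
      "C = C1 \<union> walk_edges P \<union> C2"
  using assms unfolding sign_circuit_def by blast

lemma sign_circuit_contains_figure:
  assumes "sign_circuit G C" "\<And>e. e \<in> C \<Longrightarrow> \<not> loose_edge G e"
  shows "\<exists>F. F \<subseteq> C \<and> figure G F"
  using assms by (rule sign_circuit_cases)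
    (auto simp: handcuff_def dest: positive_circle_figure)

text \<open>Two such circles would share an edge, and \<open>?K\<close> would be another positive
  circle. An edge of \<open>C1\<close> lies in only one of \<open>C2\<close> and \<open>?K\<close>;
  comparing with the pair \<open>N\<close>, \<open>?K\<close> and the pair \<open>N\<close>,
  \<open>C2\<close> therefore puts all of \<open>C1\<close> into \<open>N\<close>, which no other
  figure fits into.\<close>

lemma positive_circle_unique:
  assumes T: "connected_subgraph G X T" "card T \<le> card X + 1"
    and N: "negative_figure G N" "N \<subseteq> T"
    and C: "positive_circle G C1" "C1 \<subseteq> T" "positive_circle G C2" "C2 \<subseteq> T"
  shows "C1 = C2"
proof (rule ccontr)
  assume ne: "C1 \<noteq> C2"
  note fig = negative_figure_figure[OF N(1)] positive_circle_figure[OF C(1)] positive_circle_figure[OF C(3)]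
  have neN: "C1 \<noteq> N" "C2 \<noteq> N" using N(1) C not_positive_negative by blast+
  have circ: "circle G C1" "circle G C2" using C by (auto simp: positive_circle_def)
  have "C1 \<inter> C2 \<noteq> {}"
    by (rule three_figures_inter[OF T fig(2) C(2) fig(3) C(4) fig(1) N(2) ne neN])
  let ?K = "(C1 - C2) \<union> (C2 - C1)"
  have "circle G ?K"
    by (rule circle_sym_diff[OF T circ(1) C(2) circ(2) C(4) ne \<open>C1 \<inter> C2 \<noteq> {}\<close>])
  moreover have "(\<Prod>e\<in>?K. esign G e) = 1"
    using circle_edges[OF circ(1)] circle_edges[OF circ(2)] finite_edge_set C
    by (intro sign_sym_diff) (auto simp: positive_circle_def)
  ultimately have K: "positive_circle G ?K" by (simp add: positive_circle_def)
  have figK: "figure G ?K" using K by (rule positive_circle_figure)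
  have neK: "N \<noteq> ?K" using K N(1) not_positive_negative by blast
  have KT: "?K \<subseteq> T" using C by auto
  have "e \<in> N" if e: "e \<in> C1" for e
    using three_figures_edge[OF T fig(2) C(2) e fig(1) N(2) figK KT neK]
      three_figures_edge[OF T fig(2) C(2) e fig(1) N(2) fig(3) C(4)] neN e by blast
  then show False using figure_subset_eq[OF fig(2,1)] neN by blast
qed

text \<open>With \<open>C\<close> as a third figure, \<open>C1\<close> and \<open>C2\<close> would
  share an edge.\<close>

lemma positive_circle_no_handcuff:
  assumes T: "connected_subgraph G X T" "card T \<le> card X + 1"
    and C: "positive_circle G C" "C \<subseteq> T"
    and H: "handcuff G C1 u P v C2" "negative_figure G C1" "negative_figure G C2" "C1 \<union> C2 \<subseteq> T"
  shows False
proof -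
  have "C1 \<noteq> C" "C2 \<noteq> C" using C H not_positive_negative by blast+
  moreover have "C1 \<noteq> C2" using H by (simp add: handcuff_def)
  ultimately have "C1 \<inter> C2 \<noteq> {}"
    using H(4) C(2) positive_circle_figure[OF C(1)] negative_figure_figure[OF H(2)] negative_figure_figure[OF H(3)]
    by (intro three_figures_inter[OF T, of C1 C2 C]) auto
  then show False using handcuff_figures_disjoint[OF H(1)] by simp
qed

text \<open>Used to reroute around a deleted edge of a connecting path: its two ends remain attached
  to the two ends of the path.\<close>

lemma walk_edges_split:
  assumes "walk G u W v" "distinct (map fst W)" "e \<in> walk_edges W"
  obtains a b where "joined G (walk_edges W - {e}) u a" "joined G (walk_edges W - {e}) b v"
    "set (ends G e) = {a, b}"
proof -
  have "\<exists>a b. joined G (walk_edges W - {e}) u a \<and> joined G (walk_edges W - {e}) b v \<and>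
      set (ends G e) = {a, b}"
    using assms
  proof (induction W arbitrary: u)
    case Nil
    then show ?case by simp
  next
    case (Cons s W)
    obtain f i where s: "s = (f, i)" by fastforce
    let ?w = "step_target G s"
    have f: "two_ended G f" "set (ends G f) = {u, ?w}" and W: "walk G ?w W v"
      using Cons.prems(1) s step_ends[of f i] by auto
    have fW: "f \<notin> walk_edges W" using Cons.prems(2) s by (auto simp: walk_edges_def)
    show ?case
    proof (cases "f = e")
      case True
      have "joined G (walk_edges W) ?w v" using W by (auto simp: joined_def)
      then have "joined G (walk_edges (s # W) - {e}) ?w v"
        by (rule joined_mono) (use True s fW in auto)
      moreover have "joined G (walk_edges (s # W) - {e}) u u"
        using walk_end_in_verts[OF Cons.prems(1)] joined_refl by blast
      ultimately show ?thesis using f True by blast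
    next
      case False
      then obtain a b where ab: "joined G (walk_edges W - {e}) ?w a" "joined G (walk_edges W - {e}) b v"
          "set (ends G e) = {a, b}"
        using Cons.IH[OF W] Cons.prems s by auto
      have sub: "walk_edges W - {e} \<subseteq> walk_edges (s # W) - {e}" by auto
      have "joined G (walk_edges (s # W) - {e}) u ?w"
        using False s f by (intro joined_edge[of f]) auto
      then have "joined G (walk_edges (s # W) - {e}) u a"
        using joined_mono[OF ab(1) sub] by (rule joined_trans)
      then show ?thesis using joined_mono[OF ab(2) sub] ab(3) by blast
    qed
  qed
  then show ?thesis using that by blast
qed

text \<open>
  Both handcuffs have the same figures, so an edge of one connecting path outside the other
  handcuff could be deleted without disconnecting \<open>T\<close> or destroying a figure.
\<close>

lemma handcuff_subset:
  assumes T: "connected_subgraph G X T" "card T \<le> card X + 1"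
    and H: "handcuff G C1 u P v C2" "C1 \<union> walk_edges P \<union> C2 \<subseteq> T"
    and H': "handcuff G C1' u' P' v' C2'" "C1' \<union> walk_edges P' \<union> C2' \<subseteq> T"
  shows "C1 \<union> walk_edges P \<union> C2 \<subseteq> C1' \<union> walk_edges P' \<union> C2'" (is "?D \<subseteq> ?D'")
proof (rule ccontr)
  assume "\<not> ?D \<subseteq> ?D'"
  have fig: "figure G C1" "figure G C2" "C1 \<noteq> C2" "figure G C1'" "figure G C2'" "C1' \<noteq> C2'"
    using H(1) H'(1) by (auto simp: handcuff_def)
  \<comment> \<open>A third figure would make \<open>C1\<close> and \<open>C2\<close> share an edge,
    which a handcuff excludes.\<close>
  have same: "F = C1 \<or> F = C2" if "figure G F" "F \<subseteq> T" for F
  proof (rule ccontr)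
    assume "\<not> (F = C1 \<or> F = C2)"
    then have "C1 \<inter> C2 \<noteq> {}"
      using H(2) that fig by (intro three_figures_inter[OF T, of C1 C2 F]) auto
    then show False using handcuff_figures_disjoint[OF H(1)] by simp
  qed
  then have "C1' = C1 \<or> C1' = C2" "C2' = C1 \<or> C2' = C2" using fig H'(2) by auto
  then have eq: "C1' \<union> C2' = C1 \<union> C2" using fig by auto
  then have C12: "C1 \<subseteq> ?D'" "C2 \<subseteq> ?D'" by auto
  then obtain e where e: "e \<in> walk_edges P" "e \<notin> ?D'" using \<open>\<not> ?D \<subseteq> ?D'\<close> by blast
  have P: "walk_path G u P v" and W: "walk G u P v"
    and uv: "u \<in> verts_of G C1" "v \<in> verts_of G C2"
    using H(1) by (auto simp: handcuff_def walk_path_def)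
  have "u \<in> verts_of G ?D'" "v \<in> verts_of G ?D'"
    using subsetD[OF verts_of_mono[OF C12(1)] uv(1)] subsetD[OF verts_of_mono[OF C12(2)] uv(2)] by simp_all
  \<comment> \<open>The other handcuff contains both figures and avoids \<open>e\<close>, so it
    connects \<open>u\<close> to \<open>v\<close> after the deletion of \<open>e\<close>.\<close>
  then have "joined G ?D' u v"
    using handcuff_connected[OF H'(1) refl] by (simp add: connected_subgraph_def)
  then have uv': "joined G (T - {e}) u v" by (rule joined_mono) (use H'(2) e in auto)
  obtain a b where ab: "joined G (walk_edges P - {e}) u a" "joined G (walk_edges P - {e}) b v"
      "set (ends G e) = {a, b}"
    using walk_edges_split[OF W _ e(1)] walk_path_card[OF P] by blast
  have sub: "walk_edges P - {e} \<subseteq> T - {e}" using H(2) by auto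
  note ja = joined_mono[OF ab(1) sub] and jb = joined_mono[OF ab(2) sub]
  have jab: "joined G (T - {e}) a b"
    by (rule joined_trans[OF joined_sym[OF ja] joined_trans[OF uv' joined_sym[OF jb]]])
  have "joined G (T - {e}) c d" if "c \<in> {a, b}" "d \<in> {a, b}" for c d
    using that jab joined_sym[OF jab] joined_refl joined_in_verts[OF jab] by auto
  then have "connected_subgraph G X (T - {e})"
    using ab(3) by (intro connected_delete_edge[OF T(1)]) auto
  then have "card X < card (T - {e})"
    using fig H(2) e C12 by (intro two_figures_card_less[of X "T - {e}" C1 C2]) auto
  moreover have "card (T - {e}) < card T"
    using e H(2) finite_connected[OF T(1)] by (intro psubset_card_mono) auto
  ultimately show False using T(2) by simp
qed

text \<open>A positive circle excludes every handcuff of negative figures, so \<open>C\<close> and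
  \<open>C'\<close> are of the same kind; two handcuffs agree by inclusion in both
  directions.\<close>

lemma sign_circuit_unique:
  assumes T: "connected_subgraph G X T" "card T \<le> card X + 1"
    and no_loose: "\<And>e. e \<in> T \<Longrightarrow> \<not> loose_edge G e"
    and N: "negative_figure G N" "N \<subseteq> T"
    and C: "sign_circuit G C" "C \<subseteq> T" "sign_circuit G C'" "C' \<subseteq> T"
  shows "C = C'"
proof -
  have nl: "\<And>e. e \<in> C \<Longrightarrow> \<not> loose_edge G e" "\<And>e. e \<in> C' \<Longrightarrow> \<not> loose_edge G e"
    using no_loose C by auto
  show ?thesis
  proof (rule sign_circuit_cases[OF C(1) nl(1)])
    assume pos: "positive_circle G C"
    show ?thesis
    proof (rule sign_circuit_cases[OF C(3) nl(2)])
      assume "positive_circle G C'"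
      then show ?thesis using positive_circle_unique[OF T N pos C(2)] C(4) by blast
    next
      fix C1 u P v C2
      assume "handcuff G C1 u P v C2" "negative_figure G C1" "negative_figure G C2"
        "C' = C1 \<union> walk_edges P \<union> C2"
      then show ?thesis using positive_circle_no_handcuff[OF T pos C(2)] C(4) by blast
    qed
  next
    fix C1 u P v C2
    assume H: "handcuff G C1 u P v C2" "negative_figure G C1" "negative_figure G C2"
      "C = C1 \<union> walk_edges P \<union> C2"
    show ?thesis
    proof (rule sign_circuit_cases[OF C(3) nl(2)])
      assume "positive_circle G C'"
      then show ?thesis using positive_circle_no_handcuff[OF T _ C(4) H(1-3)] H(4) C(2) by blast
    next
      fix C1' u' P' v' C2'
      assume H': "handcuff G C1' u' P' v' C2'" "C' = C1' \<union> walk_edges P' \<union> C2'"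
      show ?thesis
        using handcuff_subset[OF T H(1) _ H'(1)] handcuff_subset[OF T H'(1) _ H(1)] C(2,4) H(4) H'(2)
        by blast
    qed
  qed
qed

text \<open>After an edge of \<open>N\<close> is given up, enough edges remain to force a second
  figure \<open>F\<close>; how \<open>F\<close> meets \<open>N\<close> decides the shape.\<close>

lemma exceptional_structure:
  assumes T: "connected_subgraph G X T" "card T = card X + 1"
    and no_loose: "\<And>e. e \<in> T \<Longrightarrow> \<not> loose_edge G e"
    and N: "negative_figure G N" "N \<subseteq> T"
  shows "\<exists>D. (unbalanced_theta G D \<or> unbalanced_handcuff G D) \<and> with_attached_trees G D T" (is ?th1)
    and "\<exists>C. C \<subseteq> T \<and> sign_circuit G C" (is ?th2)
proof -
  have le: "card T \<le> card X + 1" using T(2) by simp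
  have figN: "figure G N" using N(1) by (rule negative_figure_figure)
  then obtain e where e: "e \<in> N" using figure_nonempty by blast
  have conn: "connected_subgraph G X (T - {e})"
    by (rule connected_delete_figure_edge[OF T(1) figN N(2) e])
  have "card X \<le> card (T - {e})" using T(2) e N(2) finite_connected[OF T(1)] by auto
  then obtain F where F: "figure G F" "F \<subseteq> T - {e}"
    using contains_figure[OF conn] no_loose by auto
  then have F': "F \<subseteq> T" "N \<noteq> F" using e by auto
  have "?th1 \<and> ?th2"
  proof (cases "N \<inter> F = {}")
    case True
    obtain u P v where H: "handcuff G N u P v F" "walk_edges P \<subseteq> T"
      using handcuff_exists[OF T(1) le figN N(2) F(1) F'(1) True] by blast
    let ?D = "N \<union> walk_edges P \<union> F"
    have D: "?D \<subseteq> T" using H N F' by auto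
    have "verts_of G ?D \<noteq> {}" using figure_nonempty[OF figN] by (simp add: verts_of_Un)
    moreover have "card ?D = card (verts_of G ?D) + 1" by (rule handcuff_card[OF H(1) refl])
    ultimately have "with_attached_trees G ?D T"
      using with_attached_trees_iff_card[OF T(1) no_loose D] T(2) by simp
    moreover have "unbalanced_handcuff G ?D" using H N unfolding unbalanced_handcuff_def by blast
    moreover have "\<exists>C. C \<subseteq> T \<and> sign_circuit G C"
      using figure_sign_cases[OF F(1)]
    proof
      assume "positive_circle G F"
      then show ?thesis using F' by (auto simp: sign_circuit_def)
    next
      assume "negative_figure G F"
      then have "sign_circuit G ?D" using H N unfolding sign_circuit_def by blast
      then show ?thesis using D by blast
    qed
    ultimately show ?thesis by blast
  next
    case False
    \<comment> \<open>A common half edge would be equal to both figures, so figures sharing an edge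
      are circles here.\<close>
    have notsing: "\<not> half_edge G h" if "h \<in> N \<inter> F" for h
    proof
      assume "half_edge G h"
      then have "figure G {h}" by (auto simp: figure_def)
      then have "{h} = N" "{h} = F" using figure_subset_eq[of "{h}"] figN F(1) that by auto
      then show False using F' by simp
    qed
    then have circ: "circle G N" "circle G F" using False figN F(1) by (auto simp: figure_def)
    obtain D where D: "D \<subseteq> N \<union> F" "N \<subseteq> D" "theta_graph G D"
      using theta_exists[OF circ F'(2) False] by blast
    have DT: "D \<subseteq> T" using D N F' by auto
    have negN: "negative_circle G N"
      using N(1) circle_two_ended[OF circ(1)] not_half_two_ended by (auto simp: negative_figure_def)
    have "with_attached_trees G D T"
      using with_attached_trees_iff_card[OF T(1) no_loose DT] theta_card[OF D(3)] T(2) by simp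
    moreover have "unbalanced_theta G D" using D negN by (auto simp: unbalanced_theta_def)
    moreover have "\<exists>C. C \<subseteq> T \<and> sign_circuit G C"
    proof (cases "positive_circle G F")
      case True
      then show ?thesis using F' by (auto simp: sign_circuit_def)
    next
      case False
      then have negF: "negative_circle G F" using circle_sign_cases circ by blast
      \<comment> \<open>Two negative signs cancel, so the symmetric difference is a positive
        circle.\<close>
      let ?K = "(N - F) \<union> (F - N)"
      have "circle G ?K"
        by (rule circle_sym_diff[OF T(1) le circ(1) N(2) circ(2) F'(1,2) \<open>N \<inter> F \<noteq> {}\<close>])
      moreover have "(\<Prod>e\<in>?K. esign G e) = 1"
        using circle_edges[OF circ(1)] circle_edges[OF circ(2)] finite_edge_set negN negF
        by (intro sign_sym_diff) (auto simp: negative_circle_def)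
      ultimately have "sign_circuit G ?K" by (auto simp: sign_circuit_def positive_circle_def)
      then show ?thesis using N(2) F'(1) by (intro exI[of _ ?K]) auto
    qed
    ultimately show ?thesis by blast
  qed
  then show ?th1 ?th2 by auto
qed

section \<open>Excess of an edge component\<close>

text \<open>
  The number by which the size of an edge component exceeds the rank that it would have if it
  were hyperbalanced.  A loose edge is sign balanced but belongs to no component that
  $b_\Sigma$ counts, whence the condition on \<open>verts_of\<close>.
\<close>

definition excess :: "'e set \<Rightarrow> int" where
  "excess T = int (card T) - int (card (verts_of G T)) +
     of_bool (verts_of G T \<noteq> {} \<and> sign_balanced G T)"

lemma sign_balanced_iff: "sign_balanced G T \<longleftrightarrow> \<not> (\<exists>F. F \<subseteq> T \<and> negative_figure G F)"
  unfolding sign_balanced_def negative_figure_def by auto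

lemma excess_loose: "loose_edge G e \<Longrightarrow> excess {e} = 1"
  by (simp add: excess_def verts_of_def loose_edge_def)

lemma excess_connected:
  assumes "connected_subgraph G (verts_of G T) T"
  shows "excess T = int (card T) - int (card (verts_of G T)) + of_bool (sign_balanced G T)"
  using assms by (simp add: excess_def connected_subgraph_def)

lemma unbalanced_card_ge:
  assumes "connected_subgraph G X T" "\<not> sign_balanced G T"
  shows "card X \<le> card T"
  using assms figure_card_le negative_figure_figure unfolding sign_balanced_iff by blast

lemma excess_nonneg:
  assumes "S \<subseteq> edges G" "U \<in> edge_components G S"
  shows "0 \<le> excess U"
proof (rule edge_component_cases[OF assms])
  assume conn: "connected_subgraph G (verts_of G U) U"
  show ?thesis
    unfolding excess_connected[OF conn]
    using card_le_edges_Suc[OF conn] unbalanced_card_ge[OF conn] by (cases "sign_balanced G U") auto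
qed (simp add: excess_loose)

text \<open>The value 0 arises as -1 + 1 for a tree and as 0 + 0 for an unbalanced unicycle;
  conversely, sign balance tells which of the two is present.\<close>

lemma ordinary_iff_excess:
  assumes "S \<subseteq> edges G" "U \<in> edge_components G S"
  shows "ordinary G U \<longleftrightarrow> excess U = 0"
proof (rule edge_component_cases[OF assms])
  fix e assume e: "U = {e}" "loose_edge G e"
  have "\<not> tree G (verts_of G U) U"
    using e by (auto simp: tree_def connected_subgraph_def verts_of_def loose_edge_def)
  moreover have "\<not> unbalanced_unicycle G U"
  proof
    assume "unbalanced_unicycle G U"
    then obtain C where C: "figure G C" "C \<subseteq> {e}"
      using e negative_figure_figure by (auto simp: unbalanced_unicycle_def with_attached_trees_def)
    then have "C = {e}" using figure_nonempty by blast
    then show False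
      using C(1) e figure_nonempty[of C] by (auto simp: verts_of_def loose_edge_def)
  qed
  ultimately show ?thesis using e excess_loose by (simp add: ordinary_def)
next
  assume conn: "connected_subgraph G (verts_of G U) U" and nl: "\<And>e. e \<in> U \<Longrightarrow> \<not> loose_edge G e"
  \<comment> \<open>A figure has as many edges as vertices, so the core cancels from the criterion
    and the choice of \<open>N\<close> no longer matters.\<close>
  have att: "with_attached_trees G N U \<longleftrightarrow> card U = card (verts_of G U)"
    if "figure G N" "N \<subseteq> U" for N
    using with_attached_trees_iff_card[OF conn nl that(2)] figure_nonempty[OF that(1)] figure_card[OF that(1)]
    by auto
  show ?thesis
  proof
    assume "ordinary G U"
    then consider "tree G (verts_of G U) U" | C where "negative_figure G C" "with_attached_trees G C U"
      by (auto simp: ordinary_def unbalanced_unicycle_def)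
    then show "excess U = 0"
    proof cases
      case 1
      then have "card (verts_of G U) = card U + 1" by (rule tree_card)
      then show ?thesis
        using unbalanced_card_ge[OF conn] unfolding excess_connected[OF conn]
        by (cases "sign_balanced G U") auto
    next
      case 2
      have CU: "C \<subseteq> U" using 2(2) by (simp add: with_attached_trees_def)
      then have "\<not> sign_balanced G U" using 2(1) by (auto simp: sign_balanced_iff)
      then show ?thesis
        using att[OF negative_figure_figure[OF 2(1)] CU] 2(2) unfolding excess_connected[OF conn] by simp
    qed
  next
    assume ex: "excess U = 0"
    show "ordinary G U"
    proof (cases "sign_balanced G U")
      case True
      then have "card U < card (verts_of G U)" using ex unfolding excess_connected[OF conn] by simp
      then show ?thesis using treeI[OF conn nl] by (simp add: ordinary_def)
    next
      case False
      then obtain N where N: "N \<subseteq> U" "negative_figure G N" by (auto simp: sign_balanced_iff)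
      have "card U = card (verts_of G U)" using ex False unfolding excess_connected[OF conn] by simp
      then have "with_attached_trees G N U" using att[OF negative_figure_figure[OF N(2)] N(1)] by simp
      then show ?thesis using N by (auto simp: ordinary_def unbalanced_unicycle_def)
    qed
  qed
qed

text \<open>A figure rules out the value -1 + 1, so \<open>U\<close> is unbalanced with equally many
  edges and vertices, and its only figure is negative. This leaves no positive circle and no pair of
  figures for a handcuff.\<close>

lemma excess_0_no_sign_circuit:
  assumes "S \<subseteq> edges G" "U \<in> edge_components G S" "excess U = 0" "C \<subseteq> U"
  shows "\<not> sign_circuit G C"
proof (rule edge_component_cases[OF assms(1,2)])
  assume conn: "connected_subgraph G (verts_of G U) U" and nl: "\<And>e. e \<in> U \<Longrightarrow> \<not> loose_edge G e"
  show ?thesis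
  proof
    assume C: "sign_circuit G C"
    have nlC: "\<And>e. e \<in> C \<Longrightarrow> \<not> loose_edge G e" using nl assms(4) by blast
    obtain F where F: "F \<subseteq> U" "figure G F"
      using sign_circuit_contains_figure[OF C nlC] assms(4) by blast
    have "card (verts_of G U) \<le> card U" by (rule figure_card_le[OF conn F(2,1)])
    then have "\<not> sign_balanced G U" and le: "card U = card (verts_of G U)"
      using assms(3) unfolding excess_connected[OF conn] by (cases "sign_balanced G U"; simp)+
    then obtain N where N: "N \<subseteq> U" "negative_figure G N" by (auto simp: sign_balanced_iff)
    have unique: "F1 = F2" if "figure G F1" "F1 \<subseteq> U" "figure G F2" "F2 \<subseteq> U" for F1 F2
      using two_figures_card_less[OF conn that] le by fastforce
    show False
    proof (rule sign_circuit_cases[OF C nlC])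
      assume pos: "positive_circle G C"
      have "C = N"
        by (rule unique[OF positive_circle_figure[OF pos] assms(4) negative_figure_figure[OF N(2)] N(1)])
      then show False using pos N not_positive_negative by simp
    next
      fix C1 u P v C2
      assume "handcuff G C1 u P v C2" "C = C1 \<union> walk_edges P \<union> C2"
      then show False using unique[of C1 C2] assms(4) by (auto simp: handcuff_def)
    qed
  qed
qed (use assms(3) excess_loose in auto)

text \<open>The value 1 arises as 0 + 1 for a balanced unicycle and as 1 + 0 for theta graphs and
  handcuffs.\<close>

lemma exceptional_shape_excess:
  assumes "S \<subseteq> edges G" "U \<in> edge_components G S" "exceptional_shape G U"
  shows "excess U = 1"
proof (rule edge_component_cases[OF assms(1,2)])
  assume conn: "connected_subgraph G (verts_of G U) U" and nl: "\<And>e. e \<in> U \<Longrightarrow> \<not> loose_edge G e"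
  from assms(3) nl consider
      (unicycle) C where "positive_circle G C" "with_attached_trees G C U"
    | (theta) D where "unbalanced_theta G D" "with_attached_trees G D U"
    | (handcuff) D where "unbalanced_handcuff G D" "with_attached_trees G D U"
    by (auto simp: exceptional_shape_def balanced_unicycle_def)
  then show ?thesis
  proof cases
    case unicycle
    have CU: "C \<subseteq> U" using unicycle(2) by (simp add: with_attached_trees_def)
    have fig: "figure G C" using unicycle(1) by (rule positive_circle_figure)
    have eq: "card U = card (verts_of G U)"
      using with_attached_trees_iff_card[OF conn nl CU] unicycle(2) figure_nonempty[OF fig] figure_card[OF fig]
      by simp
    \<comment> \<open>A negative figure would be a second figure beside \<open>C\<close> and would
      force an additional edge.\<close>
    have "sign_balanced G U"
    proof (rule ccontr)
      assume "\<not> sign_balanced G U"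
      then obtain N where N: "N \<subseteq> U" "negative_figure G N" by (auto simp: sign_balanced_iff)
      then have "N \<noteq> C" using unicycle(1) not_positive_negative by blast
      then show False
        using two_figures_card_less[OF conn negative_figure_figure[OF N(2)] N(1) fig CU] eq by simp
    qed
    then show ?thesis using eq unfolding excess_connected[OF conn] by simp
  next
    case theta
    have DU: "D \<subseteq> U" using theta(2) by (simp add: with_attached_trees_def)
    have "theta_graph G D" using theta(1) by (simp add: unbalanced_theta_def)
    then have "card U = card (verts_of G U) + 1"
      using with_attached_trees_iff_card[OF conn nl DU] theta(2) theta_card[of D] by simp
    moreover have "\<not> sign_balanced G U"
      using theta(1) DU unfolding unbalanced_theta_def sign_balanced_def by blast
    ultimately show ?thesis unfolding excess_connected[OF conn] by simp
  next
    case handcuff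
    then obtain C1 u P v C2 where H: "handcuff G C1 u P v C2"
        "negative_figure G C1 \<or> negative_figure G C2" "D = C1 \<union> walk_edges P \<union> C2"
      unfolding unbalanced_handcuff_def by blast
    have DU: "D \<subseteq> U" using handcuff(2) by (simp add: with_attached_trees_def)
    have "figure G C1" using H(1) by (simp add: handcuff_def)
    then have "verts_of G D \<noteq> {}" using figure_nonempty H(3) by (simp add: verts_of_Un)
    then have "card U = card (verts_of G U) + 1"
      using with_attached_trees_iff_card[OF conn nl DU] handcuff(2) handcuff_card[OF H(1,3)] by simp
    moreover have "\<not> sign_balanced G U"
      using H(2,3) DU unfolding sign_balanced_iff by blast
    ultimately show ?thesis unfolding excess_connected[OF conn] by simp
  qed
qed (simp add: excess_loose)

text \<open>If \<open>U\<close> is balanced and not a loose edge, its counts allow just one figure,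
  a positive circle; if unbalanced, it has one edge more than vertices and a negative figure to
  start from.\<close>

lemma excess_1_exceptional:
  assumes "S \<subseteq> edges G" "U \<in> edge_components G S" "excess U = 1"
  shows "exceptional_shape G U" "\<exists>!C. C \<subseteq> U \<and> sign_circuit G C"
proof -
  have "exceptional_shape G U \<and> (\<exists>!C. C \<subseteq> U \<and> sign_circuit G C)"
  proof (rule edge_component_cases[OF assms(1,2)])
    fix e assume e: "U = {e}" "loose_edge G e"
    have "C = U" if "C \<subseteq> U" "sign_circuit G C" for C
    proof -
      have "C \<noteq> {}"
        using that(2) figure_nonempty
        by (auto simp: sign_circuit_def handcuff_def dest: positive_circle_figure)
      then show ?thesis using that e by auto
    qed
    moreover have "sign_circuit G U" using e by (auto simp: sign_circuit_def)
    ultimately show ?thesis using e by (auto simp: exceptional_shape_def)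
  next
    assume conn: "connected_subgraph G (verts_of G U) U" and nl: "\<And>e. e \<in> U \<Longrightarrow> \<not> loose_edge G e"
    show ?thesis
    proof (cases "sign_balanced G U")
      case True
      then have eq: "card U = card (verts_of G U)"
        using assms(3) unfolding excess_connected[OF conn] by simp
      then obtain F where F: "figure G F" "F \<subseteq> U" using contains_figure[OF conn nl] by auto
      then have pos: "positive_circle G F" using figure_sign_cases True by (auto simp: sign_balanced_iff)
      have unique: "F' = F" if "figure G F'" "F' \<subseteq> U" for F'
        using two_figures_card_less[OF conn that F] eq by fastforce
      have "with_attached_trees G F U"
        using with_attached_trees_iff_card[OF conn nl F(2)] eq figure_nonempty[OF F(1)] figure_card[OF F(1)]
        by simp
      then have "exceptional_shape G U"
        using pos by (auto simp: exceptional_shape_def balanced_unicycle_def)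
      moreover have "C = F" if C: "C \<subseteq> U" "sign_circuit G C" for C
      proof (rule sign_circuit_cases[OF C(2)])
        show "\<not> loose_edge G e" if "e \<in> C" for e using that C(1) nl by blast
      next
        assume "positive_circle G C"
        then show ?thesis using unique C(1) positive_circle_figure by blast
      next
        fix C1 u P v C2
        assume "negative_figure G C1" "C = C1 \<union> walk_edges P \<union> C2"
        then show ?thesis using C(1) True by (auto simp: sign_balanced_iff)
      qed
      moreover have "sign_circuit G F" using pos by (simp add: sign_circuit_def)
      ultimately show ?thesis using F(2) by blast
    next
      case False
      then obtain N where N: "N \<subseteq> U" "negative_figure G N" by (auto simp: sign_balanced_iff)
      have eq: "card U = card (verts_of G U) + 1"
        using assms(3) False unfolding excess_connected[OF conn] by simp
      then have le: "card U \<le> card (verts_of G U) + 1" by simp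
      note str = exceptional_structure[OF conn eq nl N(2,1)]
      have "exceptional_shape G U" using str(1) by (auto simp: exceptional_shape_def)
      then show ?thesis using str(2) sign_circuit_unique[OF conn le nl N(2,1)] by blast
    qed
  qed
  then show "exceptional_shape G U" "\<exists>!C. C \<subseteq> U \<and> sign_circuit G C" by auto
qed

text \<open>Apart from loose edges, sign circuits are connected.\<close>

lemma sign_circuit_in_edge_component:
  assumes "S \<subseteq> edges G" "sign_circuit G C" "C \<subseteq> S"
  obtains U where "U \<in> edge_components G S" "C \<subseteq> U"
proof -
  have conn: "connected_subgraph G (verts_of G C) C" if "\<not> (\<exists>e. loose_edge G e \<and> C = {e})"
    using assms(2) that handcuff_connected unfolding sign_circuit_def positive_circle_def circle_def
    by blast
  show ?thesis
  proof (cases "\<exists>e. loose_edge G e \<and> C = {e}")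
    case True
    then have "C \<in> edge_components G S" using assms(3) by (auto simp: edge_components_def)
    then show ?thesis using that by blast
  next
    case False
    have cn: "connected_subgraph G (verts_of G C) C" using conn False by blast
    then obtain e where e: "e \<in> C" "set (ends G e) \<noteq> {}"
      by (auto simp: connected_subgraph_def verts_of_def)
    show ?thesis
    proof (rule connected_in_edge_component[OF assms(1) cn assms(3)])
      show "C \<noteq> {}" using e by auto
    next
      fix f assume f: "f \<in> C"
      consider "positive_circle G C" | C1 u P v C2 where "handcuff G C1 u P v C2"
        "C = C1 \<union> walk_edges P \<union> C2"
        using assms(2) False unfolding sign_circuit_def by blast
      then show "\<not> loose_edge G f"
      proof cases
        case 1
        then show ?thesis using f circle_two_ended
          by (fastforce simp: positive_circle_def two_ended_def loose_edge_def)
      next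
        case 2
        have "f \<in> F \<Longrightarrow> figure G F \<Longrightarrow> \<not> loose_edge G f" for F
          using circle_two_ended[of F f]
          by (auto simp: figure_def two_ended_def loose_edge_def half_edge_def)
        moreover have "f \<in> walk_edges P \<Longrightarrow> \<not> loose_edge G f"
          using 2(1) walk_edges_two_ended[of u P v f]
          by (auto simp: handcuff_def walk_path_def two_ended_def loose_edge_def)
        ultimately show ?thesis using 2 f by (auto simp: handcuff_def)
      qed
    qed (rule that)
  qed
qed

section \<open>Independence\<close>

lemma finite_graph_components: "finite (graph_components G S)"
  using finite_verts by (simp add: graph_components_def)

lemma graph_component_excess:
  assumes "S \<subseteq> edges G" "(X, T) \<in> graph_components G S"
  shows "excess T = int (card T) - int (card X) + of_bool (sign_balanced G T)"
proof (cases "T = {}")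
  \<comment> \<open>For an isolated vertex the formula gives 0 - 1 + 1, which agrees with the excess
    of the empty set, whose indicator is 0 by the condition on \<open>verts_of\<close>.\<close>
  case True
  have conn: "connected_subgraph G X {}" using graph_component_connected[OF assms] True by simp
  then have "card X \<le> 1" using card_le_edges_Suc[OF conn] by simp
  moreover have "card X > 0"
    using conn finite_connected[OF conn] by (auto simp: connected_subgraph_def card_gt_0_iff)
  ultimately have "card X = 1" by simp
  moreover have "sign_balanced G {}"
    using figure_nonempty negative_figure_figure by (auto simp: sign_balanced_iff)
  ultimately show ?thesis using True by (simp add: excess_def)
next
  case False
  have conn: "connected_subgraph G X T" by (rule graph_component_connected[OF assms])
  have "T = edges_at G S X" using assms(2) by (rule graph_componentE)
  then have "verts_of G T \<noteq> {}" using False by (auto simp: verts_of_def edges_at_def)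
  then have "verts_of G T = X" by (rule connected_subgraph_nonempty_verts[OF conn])
  then show ?thesis using excess_connected[of T] conn by simp
qed

lemma graph_component_edge_component:
  "(X, T) \<in> graph_components G S \<Longrightarrow> T \<noteq> {} \<Longrightarrow> T \<in> edge_components G S"
  by (auto simp: edge_components_def)

text \<open>The second claim makes the natural subtraction in \<open>matroid_rank\<close> exact, so
  that rank and excess can be compared over the integers.\<close>

lemma sum_excess:
  assumes S: "S \<subseteq> edges G"
  shows "(\<Sum>U\<in>edge_components G S. excess U) =
    int (card S) + int (num_balanced G S) - int (card (verts G))" (is ?sum)
    and "num_balanced G S \<le> card (verts G)" (is ?le)
proof -
  let ?K = "graph_components G S"
  have finK: "finite ?K" by (rule finite_graph_components)
  have conn: "connected_subgraph G (fst p) (snd p)" if "p \<in> ?K" for p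
    using graph_component_connected[OF S, of "fst p" "snd p"] that by simp
  have dis: "fst p \<inter> fst q = {}" if "p \<in> ?K" "q \<in> ?K" "p \<noteq> q" for p q
    using graph_component_eq[of "fst p" "snd p" S "fst q" "snd q"] that prod_eq_iff[of p q] by auto
  have verts: "verts G = (\<Union>p\<in>?K. fst p)"
  proof (intro equalityI subsetI)
    fix v assume "v \<in> verts G"
    then obtain X T where "(X, T) \<in> ?K" "v \<in> X" by (rule graph_component_of_vert)
    then show "v \<in> (\<Union>p\<in>?K. fst p)" by force
  next
    fix v assume "v \<in> (\<Union>p\<in>?K. fst p)"
    then show "v \<in> verts G" using conn unfolding connected_subgraph_def by blast
  qed
  have cardV: "card (verts G) = (\<Sum>p\<in>?K. card (fst p))"
    unfolding verts using finK dis finite_connected(1)[OF conn] by (intro card_UN_disjoint) auto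
  have nb: "num_balanced G S = (\<Sum>p\<in>?K. of_bool (sign_balanced G (snd p)))"
    unfolding num_balanced_def using finK
    by (simp add: sum.If_cases of_bool_def Int_def case_prod_beta')
  have "of_bool (sign_balanced G (snd p)) \<le> card (fst p)" if "p \<in> ?K" for p
    using conn[OF that] finite_connected[OF conn[OF that]]
    by (auto simp: connected_subgraph_def of_bool_def Suc_le_eq card_gt_0_iff)
  then show ?le unfolding cardV nb by (rule sum_mono)
  have cardS: "card S = (\<Sum>U\<in>edge_components G S. card U)"
  proof -
    have "S = (\<Union>U\<in>edge_components G S. U)"
      using edge_component_of_edge[OF S] edge_component_subset[OF S] by blast
    moreover have "card (\<Union>U\<in>edge_components G S. U) = (\<Sum>U\<in>edge_components G S. card U)"
      using finite_edge_components[OF S] edge_components_disjoint[OF S]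
        edge_component_subset[OF S] finite_subset[OF _ finite_edge_set[OF S]]
      by (intro card_UN_disjoint) auto
    ultimately show ?thesis by simp
  qed
  let ?L = "{{e} | e. e \<in> S \<and> loose_edge G e}"
  \<comment> \<open>Isolated vertices all have the empty edge set, so only components with edges are
    determined by their edge sets.\<close>
  let ?K' = "{p \<in> ?K. snd p \<noteq> {}}"
  have EC: "edge_components G S = ?L \<union> snd ` ?K'"
    by (auto simp: edge_components_def image_iff)
  have finL: "finite ?L" "finite (snd ` ?K')"
    using finite_edge_components[OF S] unfolding EC by auto
  have disL: "?L \<inter> snd ` ?K' = {}"
  proof (rule ccontr)
    assume "?L \<inter> snd ` ?K' \<noteq> {}"
    then obtain e p where ep: "loose_edge G e" "p \<in> ?K" "snd p = {e}" by auto
    then have "(fst p, snd p) \<in> ?K" by (metis prod.collapse)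
    then have "snd p = edges_at G S (fst p)" by (rule graph_componentE)
    then have "e \<in> edges_at G S (fst p)" using ep by auto
    then show False using ep(1) by (simp add: edges_at_def loose_edge_def)
  qed
  have inj: "inj_on snd ?K'"
  proof (rule inj_onI)
    fix p q assume pq: "p \<in> ?K'" "q \<in> ?K'" "snd p = snd q"
    have "fst r = verts_of G (snd r)" if "r \<in> ?K'" for r
    proof -
      have "(fst r, snd r) \<in> ?K" using that by (metis (lifting) mem_Collect_eq prod.collapse)
      then have "snd r = edges_at G S (fst r)" by (rule graph_componentE)
      then have "verts_of G (snd r) \<noteq> {}" using that by (auto simp: verts_of_def edges_at_def)
      then show ?thesis using connected_subgraph_nonempty_verts[OF conn] that by auto
    qed
    then show "p = q" using pq by (simp add: prod_eq_iff)
  qed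
  have zero: "excess {} = 0" "card ({} :: 'e set) = 0" by (simp_all add: excess_def)
  \<comment> \<open>\<open>f {} = 0\<close> lets the isolated vertices, which are no edge
    components, back into the sum.\<close>
  have split: "(\<Sum>U\<in>edge_components G S. f U) = (\<Sum>U\<in>?L. f U) + (\<Sum>p\<in>?K. f (snd p))"
    if "f {} = 0" for f :: "'e set \<Rightarrow> int"
  proof -
    have "(\<Sum>U\<in>edge_components G S. f U) = (\<Sum>U\<in>?L. f U) + (\<Sum>U\<in>snd ` ?K'. f U)"
      unfolding EC by (rule sum.union_disjoint[OF finL disL])
    also have "(\<Sum>U\<in>snd ` ?K'. f U) = (\<Sum>p\<in>?K'. f (snd p))"
      by (rule sum.reindex_cong[OF inj]) auto
    also have "\<dots> = (\<Sum>p\<in>?K. f (snd p))"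
      using finK that by (intro sum.mono_neutral_left) auto
    finally show ?thesis .
  qed
  \<comment> \<open>With \<open>card U\<close> taken off, loose edges contribute nothing and only
    vertices and balanced components are left to count.\<close>
  have "(\<Sum>U\<in>edge_components G S. excess U) - int (card S) =
      (\<Sum>U\<in>edge_components G S. excess U - int (card U))"
    by (simp add: cardS sum_subtractf)
  also have "\<dots> = (\<Sum>U\<in>?L. excess U - int (card U)) + (\<Sum>p\<in>?K. excess (snd p) - int (card (snd p)))"
    by (rule split) (simp add: zero)
  also have "(\<Sum>U\<in>?L. excess U - int (card U)) = 0"
    by (rule sum.neutral) (auto simp: excess_loose)
  also have "(\<Sum>p\<in>?K. excess (snd p) - int (card (snd p))) =
      (\<Sum>p\<in>?K. of_bool (sign_balanced G (snd p)) - int (card (fst p)))"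
  proof (rule sum.cong[OF refl])
    fix p assume "p \<in> ?K"
    then show "excess (snd p) - int (card (snd p)) =
        of_bool (sign_balanced G (snd p)) - int (card (fst p))"
      using graph_component_excess[OF S, of "fst p" "snd p"] by simp
  qed
  also have "\<dots> = int (num_balanced G S) - int (card (verts G))"
    unfolding cardV nb by (simp add: sum_subtractf)
  finally show ?sum by linarith
qed

lemma independent_iff_sum_excess:
  assumes "S \<subseteq> edges G"
  shows "matroid_independent G S \<longleftrightarrow>
    (\<Sum>U\<in>edge_components G S. excess U) = of_bool (\<not> hyperbalanced G S)"
  using sum_excess[OF assms] assms
  by (auto simp: matroid_independent_def matroid_rank_def)

text \<open>There is no sign circuit at all, so neutrality holds vacuously.\<close>

lemma excess_0_hyperbalanced:
  assumes "S \<subseteq> edges G" "\<And>U. U \<in> edge_components G S \<Longrightarrow> excess U = 0"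
  shows "hyperbalanced G S"
  unfolding hyperbalanced_def
proof (intro allI impI, elim conjE)
  fix C assume C: "C \<subseteq> S" "sign_circuit G C"
  obtain U where "U \<in> edge_components G S" "C \<subseteq> U"
    by (rule sign_circuit_in_edge_component[OF assms(1) C(2,1)])
  then show "neutral_circuit G C" using excess_0_no_sign_circuit[OF assms(1)] assms(2) C(2) by blast
qed

text \<open>Passing to edge components drops the isolated vertices, which are trees, and adds the
  loose edges, which are never ordinary and thereby express the last condition of
  \<open>type_I\<close>.\<close>

lemma type_I_iff:
  assumes S: "S \<subseteq> edges G"
  shows "type_I G S \<longleftrightarrow> hyperbalanced G S \<and> (\<forall>U\<in>edge_components G S. ordinary G U)"
proof -
  have comp: "tree G X T \<or> unbalanced_unicycle G T \<longleftrightarrow> T = {} \<or> ordinary G T"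
    if p: "(X, T) \<in> graph_components G S" for X T
  proof (cases "T = {}")
    case True
    then have "tree G X T"
      using graph_component_connected[OF S p] circle_nonempty by (auto simp: tree_def)
    then show ?thesis using True by simp
  next
    case False
    have "T = edges_at G S X" using p by (rule graph_componentE)
    then have "verts_of G T \<noteq> {}" using False by (auto simp: verts_of_def edges_at_def)
    then have "verts_of G T = X"
      by (rule connected_subgraph_nonempty_verts[OF graph_component_connected[OF S p]])
    then show ?thesis using False by (simp add: ordinary_def)
  qed
  have loose: "\<not> ordinary G {e}" if "e \<in> S" "loose_edge G e" for e
  proof -
    have "{e} \<in> edge_components G S" using that by (auto simp: edge_components_def)
    then show ?thesis using ordinary_iff_excess[OF S] excess_loose[OF that(2)] by simp
  qed
  show ?thesis
  proof
    assume t: "type_I G S"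
    have "ordinary G U" if U: "U \<in> edge_components G S" for U
    proof (rule edge_component_cases[OF S U])
      show "ordinary G U" if "e \<in> S" "loose_edge G e" for e
        using that t by (auto simp: type_I_def)
    next
      assume "(verts_of G U, U) \<in> graph_components G S" "U \<noteq> {}"
      moreover from this have "tree G (verts_of G U) U \<or> unbalanced_unicycle G U"
        using t unfolding type_I_def by blast
      ultimately show ?thesis using comp by blast
    qed
    then show "hyperbalanced G S \<and> (\<forall>U\<in>edge_components G S. ordinary G U)"
      using t by (simp add: type_I_def)
  next
    assume o: "hyperbalanced G S \<and> (\<forall>U\<in>edge_components G S. ordinary G U)"
    have "tree G X T \<or> unbalanced_unicycle G T" if "(X, T) \<in> graph_components G S" for X T
      using o comp[OF that] graph_component_edge_component[OF that] by blast
    moreover have "\<not> (\<exists>e\<in>S. loose_edge G e)"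
      using o loose by (auto simp: edge_components_def)
    ultimately show "type_I G S" using o by (auto simp: type_I_def)
  qed
qed

lemma independent_iff_type:
  assumes S: "S \<subseteq> edges G"
  shows "matroid_independent G S \<longleftrightarrow> type_I G S \<or> type_II G S"
proof -
  let ?E = "edge_components G S"
  let ?B = "{U \<in> ?E. \<not> ordinary G U}"
  have fin: "finite ?E" by (rule finite_edge_components[OF S])
  have nonneg: "\<And>U. U \<in> ?E \<Longrightarrow> 0 \<le> excess U" by (rule excess_nonneg[OF S])
  have ord: "ordinary G U \<longleftrightarrow> excess U = 0" if "U \<in> ?E" for U by (rule ordinary_iff_excess[OF S that])
  have sumB: "(\<Sum>U\<in>?E. excess U) = (\<Sum>U\<in>?B. excess U)"
    using fin ord by (intro sum.mono_neutral_right) auto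
  show ?thesis
  proof (cases "hyperbalanced G S")
    case True
    have "matroid_independent G S \<longleftrightarrow> (\<forall>U\<in>?E. excess U = 0)"
      using independent_iff_sum_excess[OF S] True sum_nonneg_eq_0_iff[OF fin nonneg] by simp
    then show ?thesis using True ord type_I_iff[OF S] by (simp add: type_II_def)
  next
    case False
    have indep: "matroid_independent G S \<longleftrightarrow> (\<Sum>U\<in>?B. excess U) = 1"
      using independent_iff_sum_excess[OF S] False sumB by simp
    \<comment> \<open>Some sign circuit is not neutral, and components of excess 0 contain
      none.\<close>
    have "?B \<noteq> {}" using excess_0_hyperbalanced[OF S] ord False by blast
    have "matroid_independent G S \<longleftrightarrow> type_II G S"
    proof
      assume "matroid_independent G S"
      then have sum1: "(\<Sum>U\<in>?B. excess U) = 1" using indep by simp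
      \<comment> \<open>Positive integers with sum 1 leave room for only one summand.\<close>
      have pos: "1 \<le> excess U" if "U \<in> ?B" for U
        using that nonneg[of U] ord[of U] by auto
      then have "(\<Sum>U\<in>?B. 1) \<le> (\<Sum>U\<in>?B. excess U)" by (rule sum_mono)
      then have "card ?B \<le> 1" using sum1 by simp
      moreover have "exceptional G U" if U: "U \<in> ?B" for U
      proof -
        have UE: "U \<in> ?E" using U by simp
        have "?B = {U}"
          using U \<open>card ?B \<le> 1\<close> fin card_le_Suc0_iff_eq[of ?B] by auto
        then have "excess U = 1" using sum1 by simp
        note ex = excess_1_exceptional[OF S UE this]
        \<comment> \<open>The non-neutral circuit lies in a component that is not ordinary, hence in
          \<open>U\<close>, and so it is the unique sign circuit there.\<close>
        obtain C where C: "C \<subseteq> S" "sign_circuit G C" "\<not> neutral_circuit G C"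
          using False by (auto simp: hyperbalanced_def)
        obtain U' where U': "U' \<in> ?E" "C \<subseteq> U'"
          by (rule sign_circuit_in_edge_component[OF S C(2,1)])
        then have "\<not> ordinary G U'" using excess_0_no_sign_circuit[OF S] C(2) ord by blast
        then have "C \<subseteq> U" using U' \<open>?B = {U}\<close> by blast
        then show ?thesis using ex C unfolding exceptional_def by metis
      qed
      ultimately show "type_II G S" using False by (auto simp: type_II_def)
    next
      assume t: "type_II G S"
      then have "card ?B \<le> 1" by (simp add: type_II_def)
      \<comment> \<open>\<open>type_II\<close> only bounds the number of such components by 1; that
        there is one comes from hyperfrustration.\<close>
      moreover obtain U where U: "U \<in> ?B" using \<open>?B \<noteq> {}\<close> by blast
      ultimately have "?B = {U}" using fin card_le_Suc0_iff_eq[of ?B] by auto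
      moreover have "exceptional G U" using t U by (auto simp: type_II_def)
      then have "excess U = 1"
        using exceptional_shape_excess[OF S, of U] U by (auto simp: exceptional_def)
      ultimately show "matroid_independent G S" using indep by simp
    qed
    then show ?thesis using False by (simp add: type_I_def)
  qed
qed

end

theorem theorem7p3:
  fixes \<Upsilon> :: "('v, 'e, 'k :: field) gain_graph" and S :: "'e set"
  assumes "gain_signed_graph \<Upsilon>"
    and "S \<subseteq> edges \<Upsilon>"
  shows "matroid_independent \<Upsilon> S \<longleftrightarrow> type_I \<Upsilon> S \<or> type_II \<Upsilon> S"
  by (rule gain_signed_graph.independent_iff_type[OF assms])

end
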